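(* In the setting described in the context (finite lattice, call prices satisfying (C1)–(C4), payoff $a:\mathcal X\times\mathcal T\to[0,\infty)$), we have \[ \Phi^{\mathcal X,\mathcal T}(a,\mathbf C)=\mathcal P^{\mathcal X,\mathcal T}(a,\mathbf C)=\mathcal H^{\mathcal X,\mathcal T}(a,\mathbf C)=\Psi^{\mathcal X,\mathcal T}(a,\mathbf C). \] In particular, the supremum $\mathcal P^{\mathcal X,\mathcal T}(a,\mathbf C)$ of model-based prices over consistent models is attained by a price/regime model, i.e. there is $M\in\mathcal M_2^{\mathcal X,\mathcal T}(\mathbf C)$ with $\phi(M)=\mathcal P^{\mathcal X,\mathcal T}(a,\mathbf C)$; and there is a super-replicating Markovian semi-static strategy whose cost equals $\mathcal H^{\mathcal X,\mathcal T}(a,\mathbf C)$, i.e. is the lowest among all super-replicating semi-static strategies.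
   Context: Setting. Fix integers $N\ge 1$, $J\ge1$, times $0=t_0<t_1<\dots<t_N=T$, $\mathcal T=\{t_1,\dots,t_N\}$, an initial price $s_0>0$, strikes $0<x_1<\dots<x_J$, $x_0=0$ and $\mathcal X=\{x_0,x_1,\dots,x_J\}$. All prices are discounted (zero interest). A matrix $\mathbf C=(c_{j,n})_{0\le j\le J,1\le n\le N}$ of prices of calls paying $(X_{t_n}-x_j)^+$ at $t_n$ is given, with $c_{0,n}=s_0$, and satisfies: (C1) $s_0=c_{0,n}\ge c_{1,n}\ge\dots\ge c_{J,n}\ge0$ for all $n$; (C2) $1\ge\frac{c_{0,n}-c_{1,n}}{x_1}\ge\frac{c_{1,n}-c_{2,n}}{x_2-x_1}\ge\dots\ge\frac{c_{J-1,n}-c_{J,n}}{x_J-x_{J-1}}$ for all $n$; (C3) $c_{j,n+1}\ge c_{j,n}$ for $1\le n\le N-1$, $0\le j\le J$; (C4) $c_{J,N}=0$. Set $p_{0,n}=1-\frac{s_0-c_{1,n}}{x_1}$, $p_{j,n}=\frac{c_{j-1,n}-c_{j,n}}{x_j-x_{j-1}}-\frac{c_{j,n}-c_{j+1,n}}{x_{j+1}-x_j}$ for $1\le j<J$, $p_{J,n}=\frac{c_{J-1,n}-c_{J,n}}{x_J-x_{J-1}}$. The American payoff is a function $a:\mathcal X\times\mathcal T\to[0,\infty)$; exercise at $\tau\in\mathcal T$ pays $a(X_\tau,\tau)$. Models. $\mathcal M^{\mathcal X,\mathcal T}(\mathbf C)$ is the set of models: a probability space with filtration $(\mathcal F_{t_n})_{0\le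 n\le N}$ (not necessarily generated by $X$) and an adapted process $(X_{t_n})_{0\le n\le N}$ with $X_{t_0}=s_0$, $X_{t_n}\in\mathcal X$ for $n\ge1$, $X$ a martingale and $\mathbb P(X_{t_n}=x_j)=p_{j,n}$ for all $j,n$ (equivalently $\mathbb E[(X_{t_n}-x_j)^+]=c_{j,n}$). For a model $M$, $\phi(M)=\sup_\tau\mathbb E^M[a(X_\tau,\tau)]$, supremum over stopping times with values in $\mathcal T$; $\mathcal P^{\mathcal X,\mathcal T}(a,\mathbf C)=\sup_{M\in\mathcal M^{\mathcal X,\mathcal T}(\mathbf C)}\phi(M)$. $\mathcal M_2^{\mathcal X,\mathcal T}(\mathbf C)$ is the set of models in $\mathcal M^{\mathcal X,\mathcal T}(\mathbf C)$ whose filtration also supports an adapted process $\Delta$ with values in $\{1,2\}$, $\Delta_{t_0}=1$, such that: $\mathbb P(X_{t_{n+1}}=x_k\mid\mathcal F_{t_n})=\mathbb P(X_{t_{n+1}}=x_k\mid X_{t_n},\Delta_{t_n})$; $\Delta$ is non-decreasing with $\Delta_{t_N}=2$; and the conditional probability that $\Delta_{t_{n+1}}=2$ given $\Delta_{t_n}=1$ depends only on $n$ and $X_{t_{n+1}}$. Strategies. A semi-static strategy consists of reals $(b_{j,n})_{0\le j\le J,1\le n\le N}$ (a European claim paying $\sum_{n,j}b_{j,n}1_{\{X_{t_n}=x_j\}}$, with cost $H(\mathbf B)=\sum_{n,j}b_{j,n}p_{j,n}$) and functions $\Theta^1_{t_n}(x_{t_1},\dots,x_{t_n})$ and $\Theta^2_{t_n}(x_{t_1},\dots,x_{t_n},\rho)$,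 $1\le n\le N-1$ (stock holdings over $[t_n,t_{n+1}]$ before, resp. after, exercise at $\rho$; costless). Along a path $(x_{t_1},\dots,x_{t_N})$ with exercise at $\rho\in\mathcal T$, with $\mathcal N(\rho)=\min\{n:t_n\ge\rho\}$, the terminal payoff is $\mathcal G_T=\sum_{n,j}b_{j,n}1_{\{x_{t_n}=x_j\}}+\sum_{n=1}^{\mathcal N(\rho)-1}\Theta^1_{t_n}(x_{t_1},\dots,x_{t_n})(x_{t_{n+1}}-x_{t_n})+\sum_{n=\mathcal N(\rho)}^{N-1}\Theta^2_{t_n}(x_{t_1},\dots,x_{t_n},\rho)(x_{t_{n+1}}-x_{t_n})$. It super-replicates $a$ if $\mathcal G_T\ge a(x_\rho,\rho)$ for all paths in $\mathcal X^N$ and all $\rho\in\mathcal T$. $\mathcal H^{\mathcal X,\mathcal T}(a,\mathbf C)$ is the infimum of $H(\mathbf B)$ over super-replicating semi-static strategies. Given real arrays $e^1_{j,n},e^2_{j,n},v_{j,n}$ ($0\le j\le J$, $1\le n\le N$) and $d^1_{j,n},d^2_{j,n}$ ($1\le n\le N-1$), the associated Markovian semi-static strategy has $b_{j,n}=e^1_{j,n}+e^2_{j,n}$ for $n<N$, $b_{j,N}=e^1_{j,N}+e^2_{j,N}+v_{j,N}$, $\Theta^1_{t_n}=d^1_{j,n}$ and $\Theta^2_{t_n}=d^2_{j,n}$ whenever $x_{t_n}=x_j$. Primal LP $\mathbf L_P^{\mathcal X,\mathcal T}$: over $f_{j,n}\ge0$ ($0\le j\le J,1\le n\le N$) and $g^\delta_{j,k,n}\ge0$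 ($\delta\in\{1,2\}$, $0\le j,k\le J$, $1\le n\le N-1$), maximise $\sum_{n,j}a(x_j,t_n)f_{j,n}$ subject to: (a) $\sum_k(g^1_{j,k,n}+g^2_{j,k,n})=p_{j,n}$ for $1\le n\le N-1$; (b) $\sum_i(g^1_{i,j,n-1}+g^2_{i,j,n-1})=p_{j,n}$ for $2\le n\le N$; (c),(d) $\sum_k(x_k-x_j)g^\delta_{j,k,n}=0$ for $\delta=1,2$, $1\le n\le N-1$; (e) $f_{j,1}-\sum_kg^2_{j,k,1}\le0$, $f_{j,n}-\sum_kg^2_{j,k,n}+\sum_ig^2_{i,j,n-1}\le0$ for $1<n<N$, and $f_{j,N}+\sum_ig^2_{i,j,N-1}\le p_{j,N}$ (all for $0\le j\le J$). Its optimal value is $\Phi^{\mathcal X,\mathcal T}(a,\mathbf C)$. Dual LP $\mathbf L_H^{\mathcal X,\mathcal T}$: over reals $e^1_{j,n},e^2_{j,n},v_{j,n}$ ($0\le j\le J,1\le n\le N$) and $d^1_{j,n},d^2_{j,n}$ ($1\le n\le N-1$) with $e^1_{j,N}=e^2_{j,1}=0$, minimise $\sum_{j,n}(e^1_{j,n}+e^2_{j,n})p_{j,n}+\sum_jv_{j,N}p_{j,N}$ subject to $v_{j,n}\ge0$ and (i) $v_{j,n}\ge a(x_j,t_n)$; (ii) $e^1_{j,n}+e^2_{k,n+1}+(x_k-x_j)d^1_{j,n}\ge0$; (iii) $e^1_{j,n}+e^2_{k,n+1}+(x_k-x_j)d^2_{j,n}-v_{j,n}+v_{k,n+1}\ge0$,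 for all $0\le j,k\le J$, $1\le n\le N-1$. Its optimal value is $\Psi^{\mathcal X,\mathcal T}(a,\mathbf C)$. *)

theory Defs
  imports "HOL-Probability.Probability"
begin

text \<open>Conventions. Strikes are x 0, ..., x J (x 0 = 0), times are t 0, ..., t N (t 0 = 0),
  times t 1 .. t N form the exercise set. Call prices c j n (0 <= j <= J, 1 <= n <= N).
  The American payoff is a :: real => real => real, used at the points (x j, t n).
  Every array below is only meaningful on its index range; values outside are ignored.\<close>

definition pj :: "nat \<Rightarrow> (nat \<Rightarrow> real) \<Rightarrow> real \<Rightarrow> (nat \<Rightarrow> nat \<Rightarrow> real) \<Rightarrow> nat \<Rightarrow> nat \<Rightarrow> real" where
  "pj J x s0 c j n =
     (if j = 0 then 1 - (s0 - c 1 n) / x 1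
      else if j < J then (c (j - 1) n - c j n) / (x j - x (j - 1))
                         - (c j n - c (j + 1) n) / (x (j + 1) - x j)
      else (c (J - 1) n - c J n) / (x J - x (J - 1)))"

definition is_model :: "nat \<Rightarrow> nat \<Rightarrow> (nat \<Rightarrow> real) \<Rightarrow> real \<Rightarrow> (nat \<Rightarrow> nat \<Rightarrow> real)
    \<Rightarrow> 'a measure \<Rightarrow> (nat \<Rightarrow> 'a measure) \<Rightarrow> (nat \<Rightarrow> 'a \<Rightarrow> real) \<Rightarrow> bool" where
  "is_model N J x s0 p M F X \<longleftrightarrow>
     prob_space M
   \<and> (\<forall>n\<le>N. space (F n) = space M \<and> sets (F n) \<subseteq> sets M)
   \<and> (\<forall>m n. m \<le> n \<and> n \<le> N \<longrightarrow> sets (F m) \<subseteq> sets (F n))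
   \<and> (\<forall>n\<le>N. X n \<in> borel_measurable (F n))
   \<and> (\<forall>\<omega>\<in>space M. X 0 \<omega> = s0)
   \<and> (\<forall>n\<in>{1..N}. \<forall>\<omega>\<in>space M. X n \<omega> \<in> x ` {0..J})
   \<and> (\<forall>n<N. \<forall>A\<in>sets (F n).
        (\<integral>\<omega>. indicator A \<omega> * X (Suc n) \<omega> \<partial>M) = (\<integral>\<omega>. indicator A \<omega> * X n \<omega> \<partial>M))
   \<and> (\<forall>n\<in>{1..N}. \<forall>j\<le>J. measure M {\<omega>\<in>space M. X n \<omega> = x j} = p j n)"

definition is_stopping_time :: "nat \<Rightarrow> 'a measure \<Rightarrow> (nat \<Rightarrow> 'a measure) \<Rightarrow> ('a \<Rightarrow> nat) \<Rightarrow> bool" where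
  "is_stopping_time N M F \<tau> \<longleftrightarrow>
     (\<forall>\<omega>\<in>space M. \<tau> \<omega> \<in> {1..N})
   \<and> (\<forall>n\<in>{1..N}. {\<omega>\<in>space M. \<tau> \<omega> = n} \<in> sets (F n))"

definition phi :: "nat \<Rightarrow> (nat \<Rightarrow> real) \<Rightarrow> (real \<Rightarrow> real \<Rightarrow> real)
    \<Rightarrow> 'a measure \<Rightarrow> (nat \<Rightarrow> 'a measure) \<Rightarrow> (nat \<Rightarrow> 'a \<Rightarrow> real) \<Rightarrow> real" where
  "phi N t a M F X =
     Sup {(\<integral>\<omega>. a (X (\<tau> \<omega>) \<omega>) (t (\<tau> \<omega>)) \<partial>M) | \<tau>. is_stopping_time N M F \<tau>}"

definition model_sup :: "'a itself \<Rightarrow> nat \<Rightarrow> (nat \<Rightarrow> real) \<Rightarrow> nat \<Rightarrow> (nat \<Rightarrow> real) \<Rightarrow> real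
    \<Rightarrow> (nat \<Rightarrow> nat \<Rightarrow> real) \<Rightarrow> (real \<Rightarrow> real \<Rightarrow> real) \<Rightarrow> real" where
  "model_sup _ N t J x s0 p a =
     Sup {phi N t a M F X | (M :: 'a measure) F X. is_model N J x s0 p M F X}"

text \<open>Price/regime models (the class M_2): the filtration supports an adapted regime
  process Delta with values in {1,2}, Delta 0 = 1, non-decreasing, Delta N = 2, such that
  (i) P(X_{n+1} = x_k | F_n) is a function of (X_n, Delta_n), expressed through the defining
  property of conditional probability; (ii) given F_n and X_{n+1}, on {Delta_n = 1} the
  conditional probability of {Delta_{n+1} = 2} is a function theta of X_{n+1} only
  (theta may depend on n).\<close>

definition is_model2 :: "nat \<Rightarrow> nat \<Rightarrow> (nat \<Rightarrow> real) \<Rightarrow> real \<Rightarrow> (nat \<Rightarrow> nat \<Rightarrow> real)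
    \<Rightarrow> 'a measure \<Rightarrow> (nat \<Rightarrow> 'a measure) \<Rightarrow> (nat \<Rightarrow> 'a \<Rightarrow> real) \<Rightarrow> bool" where
  "is_model2 N J x s0 p M F X \<longleftrightarrow>
     is_model N J x s0 p M F X
   \<and> (\<exists>\<Delta> :: nat \<Rightarrow> 'a \<Rightarrow> nat.
        (\<forall>n\<le>N. \<Delta> n \<in> measurable (F n) (count_space UNIV))
      \<and> (\<forall>n\<le>N. \<forall>\<omega>\<in>space M. \<Delta> n \<omega> \<in> {1, 2})
      \<and> (\<forall>\<omega>\<in>space M. \<Delta> 0 \<omega> = 1)
      \<and> (\<forall>n<N. \<forall>\<omega>\<in>space M. \<Delta> n \<omega> \<le> \<Delta> (Suc n) \<omega>)
      \<and> (\<forall>\<omega>\<in>space M. \<Delta> N \<omega> = 2)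
      \<and> (\<forall>n<N. \<forall>k\<le>J. \<exists>h :: real \<Rightarrow> nat \<Rightarrow> real. \<forall>A\<in>sets (F n).
           measure M (A \<inter> {\<omega>\<in>space M. X (Suc n) \<omega> = x k})
             = (\<integral>\<omega>. indicator A \<omega> * h (X n \<omega>) (\<Delta> n \<omega>) \<partial>M))
      \<and> (\<forall>n<N. \<exists>\<theta> :: real \<Rightarrow> real. \<forall>A\<in>sets (F n). \<forall>k\<le>J.
           measure M (A \<inter> {\<omega>\<in>space M. \<Delta> n \<omega> = 1 \<and> X (Suc n) \<omega> = x k \<and> \<Delta> (Suc n) \<omega> = 2})
             = \<theta> (x k) * measure M (A \<inter> {\<omega>\<in>space M. \<Delta> n \<omega> = 1 \<and> X (Suc n) \<omega> = x k})))"

text \<open>A path is xp :: nat => real with xp n = x_{t_n} for n = 1..N. Theta1 n applied to the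
  list [xp 1, ..., xp n]; Theta2 n applied to this list and the exercise index rho in 1..N.\<close>

definition gainT :: "nat \<Rightarrow> nat \<Rightarrow> (nat \<Rightarrow> real) \<Rightarrow> (nat \<Rightarrow> nat \<Rightarrow> real)
    \<Rightarrow> (nat \<Rightarrow> real list \<Rightarrow> real) \<Rightarrow> (nat \<Rightarrow> real list \<Rightarrow> nat \<Rightarrow> real)
    \<Rightarrow> (nat \<Rightarrow> real) \<Rightarrow> nat \<Rightarrow> real" where
  "gainT N J x b \<Theta>1 \<Theta>2 xp \<rho> =
     (\<Sum>n=1..N. \<Sum>j\<le>J. b j n * (if xp n = x j then 1 else 0))
   + (\<Sum>n\<in>{1..<\<rho>}. \<Theta>1 n (map xp [1..<Suc n]) * (xp (Suc n) - xp n))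
   + (\<Sum>n\<in>{\<rho>..<N}. \<Theta>2 n (map xp [1..<Suc n]) \<rho> * (xp (Suc n) - xp n))"

definition super_replicates :: "nat \<Rightarrow> (nat \<Rightarrow> real) \<Rightarrow> nat \<Rightarrow> (nat \<Rightarrow> real) \<Rightarrow> (real \<Rightarrow> real \<Rightarrow> real)
    \<Rightarrow> (nat \<Rightarrow> nat \<Rightarrow> real) \<Rightarrow> (nat \<Rightarrow> real list \<Rightarrow> real) \<Rightarrow> (nat \<Rightarrow> real list \<Rightarrow> nat \<Rightarrow> real) \<Rightarrow> bool" where
  "super_replicates N t J x a b \<Theta>1 \<Theta>2 \<longleftrightarrow>
     (\<forall>xp. (\<forall>n\<in>{1..N}. xp n \<in> x ` {0..J}) \<longrightarrow>
        (\<forall>\<rho>\<in>{1..N}. gainT N J x b \<Theta>1 \<Theta>2 xp \<rho> \<ge> a (xp \<rho>) (t \<rho>)))"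

definition strat_cost :: "nat \<Rightarrow> nat \<Rightarrow> (nat \<Rightarrow> nat \<Rightarrow> real) \<Rightarrow> (nat \<Rightarrow> nat \<Rightarrow> real) \<Rightarrow> real" where
  "strat_cost N J p b = (\<Sum>n=1..N. \<Sum>j\<le>J. b j n * p j n)"

definition hedge_inf :: "nat \<Rightarrow> (nat \<Rightarrow> real) \<Rightarrow> nat \<Rightarrow> (nat \<Rightarrow> real) \<Rightarrow> (nat \<Rightarrow> nat \<Rightarrow> real)
    \<Rightarrow> (real \<Rightarrow> real \<Rightarrow> real) \<Rightarrow> real" where
  "hedge_inf N t J x p a =
     Inf {strat_cost N J p b | b \<Theta>1 \<Theta>2. super_replicates N t J x a b \<Theta>1 \<Theta>2}"

definition markov_b :: "nat \<Rightarrow> (nat \<Rightarrow> nat \<Rightarrow> real) \<Rightarrow> (nat \<Rightarrow> nat \<Rightarrow> real) \<Rightarrow> (nat \<Rightarrow> nat \<Rightarrow> real)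
    \<Rightarrow> nat \<Rightarrow> nat \<Rightarrow> real" where
  "markov_b N e1 e2 v j n = e1 j n + e2 j n + (if n = N then v j N else 0)"

definition markov_theta1 :: "nat \<Rightarrow> (nat \<Rightarrow> real) \<Rightarrow> (nat \<Rightarrow> nat \<Rightarrow> real) \<Rightarrow> nat \<Rightarrow> real list \<Rightarrow> real" where
  "markov_theta1 J x d n xs = (\<Sum>j\<le>J. if last xs = x j then d j n else 0)"

definition markov_theta2 :: "nat \<Rightarrow> (nat \<Rightarrow> real) \<Rightarrow> (nat \<Rightarrow> nat \<Rightarrow> real) \<Rightarrow> nat \<Rightarrow> real list \<Rightarrow> nat \<Rightarrow> real" where
  "markov_theta2 J x d n xs \<rho> = (\<Sum>j\<le>J. if last xs = x j then d j n else 0)"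

definition primal_feasible :: "nat \<Rightarrow> nat \<Rightarrow> (nat \<Rightarrow> real) \<Rightarrow> (nat \<Rightarrow> nat \<Rightarrow> real)
    \<Rightarrow> (nat \<Rightarrow> nat \<Rightarrow> real) \<Rightarrow> (nat \<Rightarrow> nat \<Rightarrow> nat \<Rightarrow> real) \<Rightarrow> (nat \<Rightarrow> nat \<Rightarrow> nat \<Rightarrow> real) \<Rightarrow> bool" where
  "primal_feasible N J x p f g1 g2 \<longleftrightarrow>
     (\<forall>n\<in>{1..N}. \<forall>j\<le>J. f j n \<ge> 0)
   \<and> (\<forall>n\<in>{1..<N}. \<forall>j\<le>J. \<forall>k\<le>J. g1 j k n \<ge> 0 \<and> g2 j k n \<ge> 0)
   \<and> (\<forall>n\<in>{1..<N}. \<forall>j\<le>J. (\<Sum>k\<le>J. g1 j k n + g2 j k n) = p j n)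
   \<and> (\<forall>n\<in>{2..N}. \<forall>j\<le>J. (\<Sum>i\<le>J. g1 i j (n - 1) + g2 i j (n - 1)) = p j n)
   \<and> (\<forall>n\<in>{1..<N}. \<forall>j\<le>J. (\<Sum>k\<le>J. (x k - x j) * g1 j k n) = 0)
   \<and> (\<forall>n\<in>{1..<N}. \<forall>j\<le>J. (\<Sum>k\<le>J. (x k - x j) * g2 j k n) = 0)
   \<and> (\<forall>n\<in>{1..<N}. \<forall>j\<le>J.
        f j n - (\<Sum>k\<le>J. g2 j k n) + (if 1 < n then (\<Sum>i\<le>J. g2 i j (n - 1)) else 0) \<le> 0)
   \<and> (\<forall>j\<le>J. f j N + (if 1 < N then (\<Sum>i\<le>J. g2 i j (N - 1)) else 0) \<le> p j N)"

definition Phi_val :: "nat \<Rightarrow> (nat \<Rightarrow> real) \<Rightarrow> nat \<Rightarrow> (nat \<Rightarrow> real) \<Rightarrow> (nat \<Rightarrow> nat \<Rightarrow> real)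
    \<Rightarrow> (real \<Rightarrow> real \<Rightarrow> real) \<Rightarrow> real" where
  "Phi_val N t J x p a =
     Sup {(\<Sum>n=1..N. \<Sum>j\<le>J. a (x j) (t n) * f j n) | f g1 g2. primal_feasible N J x p f g1 g2}"

definition dual_feasible :: "nat \<Rightarrow> (nat \<Rightarrow> real) \<Rightarrow> nat \<Rightarrow> (nat \<Rightarrow> real) \<Rightarrow> (real \<Rightarrow> real \<Rightarrow> real)
    \<Rightarrow> (nat \<Rightarrow> nat \<Rightarrow> real) \<Rightarrow> (nat \<Rightarrow> nat \<Rightarrow> real) \<Rightarrow> (nat \<Rightarrow> nat \<Rightarrow> real)
    \<Rightarrow> (nat \<Rightarrow> nat \<Rightarrow> real) \<Rightarrow> (nat \<Rightarrow> nat \<Rightarrow> real) \<Rightarrow> bool" where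
  "dual_feasible N t J x a e1 e2 v d1 d2 \<longleftrightarrow>
     (\<forall>j\<le>J. e1 j N = 0 \<and> e2 j 1 = 0)
   \<and> (\<forall>n\<in>{1..N}. \<forall>j\<le>J. v j n \<ge> 0 \<and> v j n \<ge> a (x j) (t n))
   \<and> (\<forall>n\<in>{1..<N}. \<forall>j\<le>J. \<forall>k\<le>J.
        e1 j n + e2 k (Suc n) + (x k - x j) * d1 j n \<ge> 0
      \<and> e1 j n + e2 k (Suc n) + (x k - x j) * d2 j n - v j n + v k (Suc n) \<ge> 0)"

definition Psi_val :: "nat \<Rightarrow> (nat \<Rightarrow> real) \<Rightarrow> nat \<Rightarrow> (nat \<Rightarrow> real) \<Rightarrow> (nat \<Rightarrow> nat \<Rightarrow> real)
    \<Rightarrow> (real \<Rightarrow> real \<Rightarrow> real) \<Rightarrow> real" where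
  "Psi_val N t J x p a =
     Inf {(\<Sum>n=1..N. \<Sum>j\<le>J. (e1 j n + e2 j n) * p j n) + (\<Sum>j\<le>J. v j N * p j N)
          | e1 e2 v d1 d2. dual_feasible N t J x a e1 e2 v d1 d2}"

end

theory Submission
  imports Defs "HOL-Library.Function_Algebras"
begin

text \<open>Let $V$ be the common value of the two linear programs. The dual program is feasible and
  bounded below by 0: constraint (ii) squeezes a minimum of affine functions between $-e^2$ and
  $e^1$, and (C3), (C4) say that the expectation of a concave function decreases in time. Strong
  duality, which we derive from Farkas' lemma for linear functionals, then gives optimal solutions
  of both programs, so no separate construction of a consistent model is needed. A dual solution is
  a super-replicating Markovian strategy. A primal solution is the law of a Markov chain of prices
  and regimes, and exercising when the regime switches earns at least the primal objective. The
  chain closes because the expected gain of a super-replicating strategy is its cost in every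
  consistent model, so $V \le \phi(M) \le H(B) \le V$ for these particular $M$ and $B$.\<close>

subsection \<open>Farkas lemma and linear programming duality\<close>

text \<open>Duality is applied with the dual program as the problem to be minimised: its variables
  are free and its constraints are lower bounds on linear functionals, so the multipliers are
  exactly \<open>f\<close>, \<open>g1\<close>, \<open>g2\<close>, and each primal constraint appears
  by comparing the coefficients of one dual variable. The arrays stay functions on all of
  \<open>nat\<close>; the vector space is then infinite-dimensional and only the number of
  functionals is finite, which is why Farkas is proved by induction on that number and why functions
  are made a real vector space here. The filtration of a consistent model is arbitrary, so its price
  is bounded by integrating the super-replication inequality, never by reduction to a Markov model.
  \<open>Sup\<close> and \<open>Inf\<close> on reals are informative only for nonempty bounded sets,
  so the four values are identified as an attained maximum or minimum. The regime conditions must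
  hold on every sample point, not almost surely; hence the chain lives on lists of states with the
  null paths removed.\<close>

instantiation "fun" :: (type, real_vector) real_vector
begin

definition "r *\<^sub>R f = (\<lambda>x. r *\<^sub>R f x)"

instance
  by standard (simp_all add: scaleR_fun_def fun_eq_iff scaleR_add_right scaleR_add_left)

end

lemma scaleR_fun_apply [simp]: "(r *\<^sub>R f) x = r *\<^sub>R f x"
  by (simp add: scaleR_fun_def)

text \<open>Induction on the number of functionals. If \<open>l m\<close> cannot be dropped, some
  \<open>z\<close> satisfies the other constraints but has \<open>u z < 0\<close>. Projecting along
  \<open>z\<close> onto the kernel of \<open>l m\<close> removes \<open>l m\<close> from the
  hypothesis, and undoing the projection produces its coefficient. The argument is purely algebraic,
  so no closedness of cones and no finite dimension enters.\<close>

theorem farkas: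
  fixes l :: "'i \<Rightarrow> 'e::real_vector \<Rightarrow> real" and u :: "'e \<Rightarrow> real"
  assumes "finite I" and "\<And>i. i \<in> I \<Longrightarrow> linear (l i)" and "linear u"
    and "\<And>y. (\<And>i. i \<in> I \<Longrightarrow> l i y \<ge> 0) \<Longrightarrow> u y \<ge> 0"
  shows "\<exists>w. (\<forall>i\<in>I. w i \<ge> 0) \<and> (\<forall>y. u y = (\<Sum>i\<in>I. w i * l i y))"
  using assms
proof (induction I arbitrary: l u rule: finite_induct)
  case empty
  have "u y = 0" for y
    using empty.prems(3)[of y] empty.prems(3)[of "-y"] linear_neg[OF empty.prems(2), of y] by simp
  then show ?case by simp
next
  case (insert m I)
  note lin = insert.prems(1) and linu = insert.prems(2)
  have linm: "linear (l m)" using lin by simp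
  show ?case
  proof (cases "\<forall>y. (\<forall>i\<in>I. l i y \<ge> 0) \<longrightarrow> u y \<ge> 0")
    case True
    then obtain w where w: "\<forall>i\<in>I. w i \<ge> 0" "\<And>y. u y = (\<Sum>i\<in>I. w i * l i y)"
      using insert.IH[of l u] lin linu by blast
    have "(\<Sum>i\<in>I. (w(m := 0)) i * l i y) = (\<Sum>i\<in>I. w i * l i y)" for y
      using insert.hyps by (intro sum.cong) auto
    then show ?thesis
      using w insert.hyps by (intro exI[of _ "w(m := 0)"]) auto
  next
    case False
    then obtain z0 where z0: "\<And>i. i \<in> I \<Longrightarrow> l i z0 \<ge> 0" "u z0 < 0" by force
    have neg: "l m z0 < 0"
      using insert.prems(3)[of z0] z0 by force
    define z where "z = (1 / - l m z0) *\<^sub>R z0"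
    have zm: "l m z = -1"
      unfolding z_def linear_cmul[OF linm] using neg by simp
    have zI: "l i z \<ge> 0" if "i \<in> I" for i
      unfolding z_def linear_cmul[OF lin[OF insertI2[OF that]]]
      using neg z0(1)[OF that] by (simp add: divide_nonpos_neg divide_nonneg_neg)
    have zu: "u z < 0"
      unfolding z_def linear_cmul[OF linu] using neg z0(2) by (simp add: divide_neg_neg)
    text \<open>Project along \<^term>\<open>z\<close> onto the kernel of \<^term>\<open>l m\<close>.\<close>
    define \<pi> where "\<pi> y = y + l m y *\<^sub>R z" for y
    have lin\<pi>: "linear \<pi>"
      unfolding \<pi>_def
      by (intro linearI) (simp_all add: linear_add[OF linm] linear_cmul[OF linm] algebra_simps)
    have m\<pi>: "l m (\<pi> y) = 0" for y
      by (simp add: \<pi>_def linear_add[OF linm] linear_cmul[OF linm] zm)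
    have ev: "f (\<pi> y) = f y + l m y * f z" if "linear f" for f :: "'e \<Rightarrow> real" and y
      by (simp add: \<pi>_def linear_add[OF that] linear_cmul[OF that])
    have "\<exists>w. (\<forall>i\<in>I. w i \<ge> 0) \<and> (\<forall>y. (u \<circ> \<pi>) y = (\<Sum>i\<in>I. w i * (l i \<circ> \<pi>) y))"
    proof (rule insert.IH)
      show "linear (l i \<circ> \<pi>)" if "i \<in> I" for i
        using lin that lin\<pi> by (intro linear_compose) auto
      show "linear (u \<circ> \<pi>)" using lin\<pi> linu by (intro linear_compose)
      show "(u \<circ> \<pi>) y \<ge> 0" if "\<And>i. i \<in> I \<Longrightarrow> (l i \<circ> \<pi>) y \<ge> 0" for y
      proof -
        have "l i (\<pi> y) \<ge> 0" if "i \<in> insert m I" for i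
          using that m\<pi>[of y] \<open>\<And>i. i \<in> I \<Longrightarrow> (l i \<circ> \<pi>) y \<ge> 0\<close> by auto
        then show ?thesis using insert.prems(3)[of "\<pi> y"] by simp
      qed
    qed
    then obtain w where w: "\<forall>i\<in>I. w i \<ge> 0" "\<And>y. u (\<pi> y) = (\<Sum>i\<in>I. w i * l i (\<pi> y))"
      by auto
    \<comment> \<open>Expanding both sides of \<open>w(2)\<close> with \<open>ev\<close> leaves this
      number as the coefficient of \<open>l m y\<close>.\<close>
    define c where "c = (\<Sum>i\<in>I. w i * l i z) - u z"
    have "c \<ge> 0"
      unfolding c_def using w(1) zI zu by (smt (verit) mult_nonneg_nonneg sum_nonneg)
    have "u y = (\<Sum>i\<in>I. w i * l i y) + c * l m y" for y
    proof -
      have "u y + l m y * u z = (\<Sum>i\<in>I. w i * l i y + l m y * (w i * l i z))"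
        unfolding ev[OF linu, symmetric] w(2) using lin
        by (intro sum.cong) (auto simp: ev algebra_simps)
      then show ?thesis
        by (simp add: c_def sum.distrib sum_distrib_left algebra_simps)
    qed
    moreover have "(\<Sum>i\<in>I. (w(m := c)) i * l i y) = (\<Sum>i\<in>I. w i * l i y)" for y
      using insert.hyps by (intro sum.cong) auto
    ultimately show ?thesis
      using w(1) \<open>c \<ge> 0\<close> insert.hyps by (intro exI[of _ "w(m := c)"]) auto
  qed
qed

text \<open>The constant \<open>b\<close> is multiplied by an extra coordinate, equal to 1 in the
  original problem; this is how the homogeneous \<open>farkas\<close> handles affine
  constraints.\<close>

lemma linear_homogenize:
  fixes f :: "'e::real_vector \<Rightarrow> real"
  assumes "linear f"
  shows "linear (\<lambda>q::'e \<times> real. f (fst q) - b * snd q)"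
  by (intro linearI) (simp_all add: linear_add[OF assms] linear_cmul[OF assms] algebra_simps)

text \<open>A homogenized solution with \<open>snd q > 0\<close> could be rescaled to a solution of
  the original system, so infeasibility forces \<open>- snd q \<ge> 0\<close> and
  \<open>farkas\<close> applies. The two claims about \<open>w\<close> are its identity at
  \<open>(y, 0)\<close> and at \<open>(0, 1)\<close>.\<close>

lemma farkas_infeasible:
  fixes l :: "'i \<Rightarrow> 'e::real_vector \<Rightarrow> real"
  assumes fin: "finite I" and lin: "\<And>i. i \<in> I \<Longrightarrow> linear (l i)"
    and infeas: "\<And>y. \<exists>i\<in>I. l i y < b i"
  shows "\<exists>w. (\<forall>i\<in>I. w i \<ge> 0) \<and> (\<forall>y. (\<Sum>i\<in>I. w i * l i y) = 0) \<and> (\<Sum>i\<in>I. w i * b i) = 1"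
proof -
  have "\<exists>w. (\<forall>i\<in>I. w i \<ge> 0) \<and>
      (\<forall>q::'e \<times> real. - snd q = (\<Sum>i\<in>I. w i * (l i (fst q) - b i * snd q)))"
  proof (rule farkas[OF fin])
    show "linear (\<lambda>q::'e \<times> real. l i (fst q) - b i * snd q)" if "i \<in> I" for i
      using lin[OF that] by (rule linear_homogenize)
    show "linear (\<lambda>q::'e \<times> real. - snd q)" by (intro linearI) auto
    fix q :: "'e \<times> real"
    assume q: "l i (fst q) - b i * snd q \<ge> 0" if "i \<in> I" for i
    show "- snd q \<ge> 0"
    proof (rule ccontr)
      assume "\<not> - snd q \<ge> 0"
      then have pos: "snd q > 0" by simp
      obtain i where i: "i \<in> I" "l i ((1 / snd q) *\<^sub>R fst q) < b i" using infeas by blast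
      then show False
        using q[OF i(1)] pos linear_cmul[OF lin[OF i(1)], of "1 / snd q" "fst q"]
        by (simp add: field_simps)
    qed
  qed
  then obtain w where w: "\<forall>i\<in>I. w i \<ge> 0"
      "\<And>q::'e \<times> real. - snd q = (\<Sum>i\<in>I. w i * (l i (fst q) - b i * snd q))" by auto
  have "l i 0 = 0" if "i \<in> I" for i using lin[OF that] by (rule linear_0)
  then have "(\<Sum>i\<in>I. w i * b i) = 1"
    using w(2)[of "(0, 1)"] by (simp add: sum_negf)
  moreover have "(\<Sum>i\<in>I. w i * l i y) = 0" for y
    using w(2)[of "(y, 0)"] by simp
  ultimately show ?thesis using w(1) by blast
qed

theorem lp_strong_duality:
  fixes l :: "'i \<Rightarrow> 'e::real_vector \<Rightarrow> real" and u :: "'e \<Rightarrow> real"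
  assumes fin: "finite I" and lin: "\<And>i. i \<in> I \<Longrightarrow> linear (l i)" and linu: "linear u"
    and feas: "\<And>i. i \<in> I \<Longrightarrow> l i y0 \<ge> b i"
    and bounded: "\<And>y. (\<And>i. i \<in> I \<Longrightarrow> l i y \<ge> b i) \<Longrightarrow> u y \<ge> L"
  obtains y w where "\<And>i. i \<in> I \<Longrightarrow> l i y \<ge> b i" "\<And>i. i \<in> I \<Longrightarrow> w i \<ge> 0"
    "\<And>y'. u y' = (\<Sum>i\<in>I. w i * l i y')" "u y \<le> (\<Sum>i\<in>I. w i * b i)"
proof -
  define S where "S = u ` {y. \<forall>i\<in>I. l i y \<ge> b i}"
  have S: "S \<noteq> {}" "bdd_below S"
    using feas bounded by (auto simp: S_def intro!: bdd_belowI[of _ L])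
  define V where "V = Inf S"
  have V: "V \<le> u y" if "\<And>i. i \<in> I \<Longrightarrow> l i y \<ge> b i" for y
    unfolding V_def using S that by (intro cInf_lower) (auto simp: S_def)
  have V_greatest: "K \<le> V" if "\<And>y. (\<And>i. i \<in> I \<Longrightarrow> l i y \<ge> b i) \<Longrightarrow> K \<le> u y" for K
    unfolding V_def using S(1) that by (intro cInf_greatest) (auto simp: S_def)

  \<comment> \<open>Attainment of the infimum comes without compactness: if it failed, adding
    \<open>u y \<le> V\<close> (index \<open>None\<close>) would give an infeasible system, and its
    certificate would improve the lower bound \<open>V\<close>.\<close>
  have "\<exists>y. (\<forall>i\<in>I. l i y \<ge> b i) \<and> u y \<le> V"
  proof (rule ccontr)
    assume no: "\<not> ?thesis"
    define l' where "l' = case_option (\<lambda>y. - u y) l"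
    define b' where "b' = case_option (- V) b"
    have "\<exists>w. (\<forall>i\<in>insert None (Some ` I). w i \<ge> 0)
        \<and> (\<forall>y. (\<Sum>i\<in>insert None (Some ` I). w i * l' i y) = 0)
        \<and> (\<Sum>i\<in>insert None (Some ` I). w i * b' i) = 1"
    proof (rule farkas_infeasible)
      show "finite (insert None (Some ` I))" using fin by simp
      show "linear (l' i)" if "i \<in> insert None (Some ` I)" for i
        using that lin linu by (auto simp: l'_def linear_compose_neg)
      show "\<exists>i\<in>insert None (Some ` I). l' i y < b' i" for y
        using no by (auto simp: l'_def b'_def not_le)
    qed
    then obtain w where w: "w None \<ge> 0" "\<And>i. i \<in> I \<Longrightarrow> w (Some i) \<ge> 0"
      "\<And>y. (\<Sum>i\<in>I. w (Some i) * l i y) = w None * u y"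
      "(\<Sum>i\<in>I. w (Some i) * b i) = 1 + w None * V"
      using fin by (auto simp: l'_def b'_def sum.reindex algebra_simps)
    have weak: "1 + w None * V \<le> w None * u y" if "\<And>i. i \<in> I \<Longrightarrow> l i y \<ge> b i" for y
      unfolding w(3,4)[symmetric] using that w(2) by (intro sum_mono mult_left_mono) auto
    show False
    proof (cases "w None = 0")
      case True
      then show False using weak[OF feas] by simp
    next
      case False
      then have pos: "w None > 0" using w(1) by simp
      \<comment> \<open>Dividing \<open>weak\<close> by \<open>w None\<close> bounds
        \<open>u\<close> below by \<open>V + 1 / w None\<close> on the feasible set.\<close>
      have "V + 1 / w None \<le> V"
        using weak pos by (intro V_greatest) (auto simp: field_simps)
      then show False using pos by simp
    qed
  qed
  then obtain y where y: "\<And>i. i \<in> I \<Longrightarrow> l i y \<ge> b i" "u y \<le> V" by blast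

  \<comment> \<open>Now \<open>None\<close> stands for the sign constraint on the homogenizing
    coordinate; its multiplier is the slack that makes the final bound an inequality.\<close>
  define l' where "l' = case_option (\<lambda>q::'e \<times> real. snd q) (\<lambda>i q. l i (fst q) - b i * snd q)"
  have "\<exists>w. (\<forall>i\<in>insert None (Some ` I). w i \<ge> 0)
      \<and> (\<forall>q. u (fst q) - V * snd q = (\<Sum>i\<in>insert None (Some ` I). w i * l' i q))"
  proof (rule farkas)
    show "finite (insert None (Some ` I))" using fin by simp
    show "linear (l' i)" if "i \<in> insert None (Some ` I)" for i
      using that lin by (auto simp: l'_def linear_homogenize linear_snd)
    show "linear (\<lambda>q. u (fst q) - V * snd q)" using linu by (rule linear_homogenize)
    fix q :: "'e \<times> real"
    assume q: "l' i q \<ge> 0" if "i \<in> insert None (Some ` I)" for i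
    have q0: "snd q \<ge> 0" using q[of None] by (simp add: l'_def)
    have qI: "l i (fst q) \<ge> b i * snd q" if "i \<in> I" for i
      using q[of "Some i"] that by (simp add: l'_def)
    show "u (fst q) - V * snd q \<ge> 0"
    proof (cases "snd q = 0")
      case False
      then have pos: "snd q > 0" using q0 by simp
      have "V \<le> u ((1 / snd q) *\<^sub>R fst q)"
      proof (rule V)
        show "l i ((1 / snd q) *\<^sub>R fst q) \<ge> b i" if "i \<in> I" for i
          using qI[OF that] pos linear_cmul[OF lin[OF that]] by (simp add: field_simps)
      qed
      then show ?thesis using pos linear_cmul[OF linu] by (simp add: field_simps)
    next
      case True
      show ?thesis
      proof (rule ccontr)
        assume "\<not> ?thesis"
        then have neg: "u (fst q) < 0" using True by simp
        \<comment> \<open>A recession direction with negative \<open>u\<close> would make the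
          program unbounded; this step length brings the objective to exactly
          \<open>L - 1\<close>.\<close>
        define r where "r = (u y0 - L + 1) / - u (fst q)"
        have "r \<ge> 0" using bounded[OF feas] neg by (auto simp: r_def intro!: divide_nonneg_neg)
        have "L \<le> u (y0 + r *\<^sub>R fst q)"
        proof (rule bounded)
          show "l i (y0 + r *\<^sub>R fst q) \<ge> b i" if "i \<in> I" for i
            using feas[OF that] qI[OF that] True \<open>r \<ge> 0\<close>
              linear_add[OF lin[OF that]] linear_cmul[OF lin[OF that]]
            by (simp add: add_increasing2)
        qed
        also have "\<dots> = u y0 + r * u (fst q)"
          by (simp add: linear_add[OF linu] linear_cmul[OF linu])
        also have "\<dots> = L - 1" using neg by (simp add: r_def)
        finally show False by simp
      qed
    qed
  qed
  then obtain w where w: "w None \<ge> 0" "\<And>i. i \<in> I \<Longrightarrow> w (Some i) \<ge> 0"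
    "\<And>q. u (fst q) - V * snd q
        = w None * snd q + (\<Sum>i\<in>I. w (Some i) * (l i (fst q) - b i * snd q))"
    using fin by (auto simp: l'_def sum.reindex)
  have "l i 0 = 0" if "i \<in> I" for i using lin[OF that] by (rule linear_0)
  then have "V \<le> (\<Sum>i\<in>I. w (Some i) * b i)"
    using w(1) w(3)[of "(0, 1)"] linear_0[OF linu] by (simp add: sum_negf)
  then show ?thesis
    using that[of y "w \<circ> Some"] y w(2) w(3)[of "(_, 0)"] by fastforce
qed

subsection \<open>Super-replication bounds model prices\<close>

text \<open>Splitting over the finitely many values of \<open>K\<close> avoids any measurability
  requirement on \<open>z\<close>: only level sets of \<open>K\<close> matter. It serves for prices,
  for trading gains with history-dependent holdings, and for payoffs at a stopping time.\<close>

lemma (in prob_space) integral_finite_valued: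
  fixes Y :: "'a \<Rightarrow> real" and z :: "'k \<Rightarrow> real"
  assumes fin: "finite S" and K: "\<And>\<omega>. \<omega> \<in> space M \<Longrightarrow> K \<omega> \<in> S"
    and meas: "\<And>s. s \<in> S \<Longrightarrow> {\<omega>\<in>space M. K \<omega> = s} \<in> sets M"
    and int: "integrable M Y"
  shows "integrable M (\<lambda>\<omega>. z (K \<omega>) * Y \<omega>)"
    and "(\<integral>\<omega>. z (K \<omega>) * Y \<omega> \<partial>M)
      = (\<Sum>s\<in>S. z s * (\<integral>\<omega>. indicator {\<omega>\<in>space M. K \<omega> = s} \<omega> * Y \<omega> \<partial>M))"
proof -
  have eq: "z (K \<omega>) * Y \<omega> = (\<Sum>s\<in>S. z s * (indicator {\<omega>\<in>space M. K \<omega> = s} \<omega> * Y \<omega>))"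
    if "\<omega> \<in> space M" for \<omega>
  proof -
    have "(\<Sum>s\<in>S. z s * (indicator {\<omega>\<in>space M. K \<omega> = s} \<omega> * Y \<omega>))
        = (\<Sum>s\<in>S. if s = K \<omega> then z s * Y \<omega> else 0)"
      using that by (intro sum.cong) (auto simp: indicator_def)
    then show ?thesis using K[OF that] fin by simp
  qed
  have int1: "integrable M (\<lambda>\<omega>. indicator {\<omega>\<in>space M. K \<omega> = s} \<omega> * Y \<omega>)" if "s \<in> S" for s
    using integrable_mult_indicator[OF meas[OF that] int] by simp
  have int2: "integrable M (\<lambda>\<omega>. \<Sum>s\<in>S. z s * (indicator {\<omega>\<in>space M. K \<omega> = s} \<omega> * Y \<omega>))"
    using int1 by (intro Bochner_Integration.integrable_sum integrable_mult_right)
  show "integrable M (\<lambda>\<omega>. z (K \<omega>) * Y \<omega>)"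
    using int2 by (subst Bochner_Integration.integrable_cong[OF refl eq])
  have "(\<integral>\<omega>. z (K \<omega>) * Y \<omega> \<partial>M)
      = (\<integral>\<omega>. (\<Sum>s\<in>S. z s * (indicator {\<omega>\<in>space M. K \<omega> = s} \<omega> * Y \<omega>)) \<partial>M)"
    by (intro Bochner_Integration.integral_cong refl eq)
  also have "\<dots> = (\<Sum>s\<in>S. z s * (\<integral>\<omega>. indicator {\<omega>\<in>space M. K \<omega> = s} \<omega> * Y \<omega> \<partial>M))"
    using int1 by (subst Bochner_Integration.integral_sum) auto
  finally show "(\<integral>\<omega>. z (K \<omega>) * Y \<omega> \<partial>M)
      = (\<Sum>s\<in>S. z s * (\<integral>\<omega>. indicator {\<omega>\<in>space M. K \<omega> = s} \<omega> * Y \<omega> \<partial>M))" .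
qed

section \<open>Expected trading gains in an arbitrary consistent model\<close>

locale lattice_model = prob_space M for M :: "'a measure" +
  fixes N J :: nat and x :: "nat \<Rightarrow> real" and s0 :: real and p :: "nat \<Rightarrow> nat \<Rightarrow> real"
    and F :: "nat \<Rightarrow> 'a measure" and X :: "nat \<Rightarrow> 'a \<Rightarrow> real"
  assumes is_model: "is_model N J x s0 p M F X"
begin

lemma space_F: "n \<le> N \<Longrightarrow> space (F n) = space M"
  using is_model by (simp add: is_model_def)

lemma sets_F: "n \<le> N \<Longrightarrow> A \<in> sets (F n) \<Longrightarrow> A \<in> sets M"
  using is_model unfolding is_model_def by (elim conjE) blast

lemma sets_F_mono: "m \<le> n \<Longrightarrow> n \<le> N \<Longrightarrow> A \<in> sets (F m) \<Longrightarrow> A \<in> sets (F n)"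
  using is_model unfolding is_model_def by (elim conjE) blast

lemma X_adapted: "n \<le> N \<Longrightarrow> X n \<in> borel_measurable (F n)"
  using is_model by (simp add: is_model_def)

lemma X_lattice: "1 \<le> n \<Longrightarrow> n \<le> N \<Longrightarrow> \<omega> \<in> space M \<Longrightarrow> X n \<omega> \<in> x ` {0..J}"
  using is_model by (simp add: is_model_def)

lemma X_martingale: "n < N \<Longrightarrow> A \<in> sets (F n) \<Longrightarrow>
    (\<integral>\<omega>. indicator A \<omega> * X (Suc n) \<omega> \<partial>M) = (\<integral>\<omega>. indicator A \<omega> * X n \<omega> \<partial>M)"
  using is_model by (simp add: is_model_def)

lemma X_marginal: "1 \<le> n \<Longrightarrow> n \<le> N \<Longrightarrow> j \<le> J \<Longrightarrow> measure M {\<omega>\<in>space M. X n \<omega> = x j} = p j n"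
  using is_model by (simp add: is_model_def)

lemma X_level_set:
  assumes "m \<le> n" "n \<le> N"
  shows "{\<omega>\<in>space M. X m \<omega> = y} \<in> sets (F n)"
proof -
  have "X m -` {y} \<inter> space (F m) \<in> sets (F m)"
    using assms by (intro measurable_sets[OF X_adapted]) auto
  moreover have "X m -` {y} \<inter> space (F m) = {\<omega>\<in>space M. X m \<omega> = y}"
    using assms space_F[of m] by auto
  ultimately show ?thesis using assms by (auto intro: sets_F_mono[of m n])
qed

lemma X_integrable:
  assumes "1 \<le> n" "n \<le> N"
  shows "integrable M (X n)"
proof -
  have "integrable M (\<lambda>\<omega>. X n \<omega> * 1)"
  proof (rule integral_finite_valued)
    show "X n \<omega> \<in> x ` {0..J}" if "\<omega> \<in> space M" for \<omega> using X_lattice[OF assms that] .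
    show "{\<omega>\<in>space M. X n \<omega> = y} \<in> sets M" for y
      using assms by (intro sets_F[OF _ X_level_set[of n n]]) auto
  qed auto
  then show ?thesis by simp
qed

text \<open>A discrete martingale transform: on each level set of \<open>K\<close>, an event of
  \<open>F n\<close>, the holding is constant and the martingale property gives a zero gain.\<close>

lemma integral_predictable_increment:
  fixes z :: "'k \<Rightarrow> real"
  assumes n: "1 \<le> n" "n < N" and fin: "finite S" and K: "\<And>\<omega>. \<omega> \<in> space M \<Longrightarrow> K \<omega> \<in> S"
    and meas: "\<And>s. s \<in> S \<Longrightarrow> {\<omega>\<in>space M. K \<omega> = s} \<in> sets (F n)"
  shows "integrable M (\<lambda>\<omega>. z (K \<omega>) * (X (Suc n) \<omega> - X n \<omega>))"
    and "(\<integral>\<omega>. z (K \<omega>) * (X (Suc n) \<omega> - X n \<omega>) \<partial>M) = 0"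
proof -
  have measM: "{\<omega>\<in>space M. K \<omega> = s} \<in> sets M" if "s \<in> S" for s
    using n by (intro sets_F[OF _ meas[OF that]]) auto
  have intX: "integrable M (X n)" "integrable M (X (Suc n))"
    using n by (auto intro!: X_integrable)
  then have int: "integrable M (\<lambda>\<omega>. X (Suc n) \<omega> - X n \<omega>)" by simp
  show "integrable M (\<lambda>\<omega>. z (K \<omega>) * (X (Suc n) \<omega> - X n \<omega>))"
    using fin K measM int by (rule integral_finite_valued)
  have "(\<integral>\<omega>. indicator {\<omega>\<in>space M. K \<omega> = s} \<omega> * (X (Suc n) \<omega> - X n \<omega>) \<partial>M) = 0"
    if "s \<in> S" for s
  proof -
    have "integrable M (\<lambda>\<omega>. indicator {\<omega>\<in>space M. K \<omega> = s} \<omega> * X m \<omega>)"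
      if "integrable M (X m)" for m
      using integrable_mult_indicator[OF measM[OF \<open>s \<in> S\<close>] that] by simp
    then show ?thesis
      using intX X_martingale[OF n(2) meas[OF that]] by (simp add: right_diff_distrib)
  qed
  then show "(\<integral>\<omega>. z (K \<omega>) * (X (Suc n) \<omega> - X n \<omega>) \<partial>M) = 0"
    using integral_finite_valued(2)[OF fin K measM int] by simp
qed

text \<open>The holding over the period after \<open>n\<close> depends on the past prices and on the
  exercise time if it is at most \<open>n\<close>. Truncating \<open>\<tau>\<close> at
  \<open>Suc n\<close> keeps just this information, all of it known at time
  \<open>n\<close>.\<close>

lemma stopped_history_measurable:
  assumes n: "1 \<le> n" "n < N" and \<tau>: "is_stopping_time N M F \<tau>"
  shows "{\<omega>\<in>space M. (map (\<lambda>m. X m \<omega>) [1..<Suc n], min (\<tau> \<omega>) (Suc n)) = (xs, r)} \<in> sets (F n)"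
proof -
  interpret Fn: sigma_algebra "space M" "sets (F n)"
    using sets.sigma_algebra_axioms[of "F n"] space_F[of n] n by simp
  have \<tau>r: "{\<omega>\<in>space M. \<tau> \<omega> = m} \<in> sets (F n)" if "m \<le> n" for m
  proof (cases "m = 0")
    case True
    then have "{\<omega>\<in>space M. \<tau> \<omega> = m} = {}" using \<tau> unfolding is_stopping_time_def by force
    then show ?thesis by (simp only: Fn.empty_sets)
  next
    case False
    then have "{\<omega>\<in>space M. \<tau> \<omega> = m} \<in> sets (F m)"
      using \<tau> that n by (simp add: is_stopping_time_def)
    with that n show ?thesis by (auto intro: sets_F_mono[of m n])
  qed
  have "{\<omega>\<in>space M. min (\<tau> \<omega>) (Suc n) = r} \<in> sets (F n)"
  proof (cases "r \<le> n")
    case True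
    then have "{\<omega>\<in>space M. min (\<tau> \<omega>) (Suc n) = r} = {\<omega>\<in>space M. \<tau> \<omega> = r}" by auto
    then show ?thesis using \<tau>r True by simp
  next
    case False
    have "{\<omega>\<in>space M. min (\<tau> \<omega>) (Suc n) = r}
        = (if r = Suc n then space M - (\<Union>m\<in>{..n}. {\<omega>\<in>space M. \<tau> \<omega> = m}) else {})"
      using False by auto
    moreover have "(\<Union>m\<in>{..n}. {\<omega>\<in>space M. \<tau> \<omega> = m}) \<in> sets (F n)"
      using \<tau>r by (intro Fn.finite_UN) auto
    ultimately show ?thesis by (auto intro: Fn.Diff)
  qed
  moreover have "{\<omega>\<in>space M. map (\<lambda>m. X m \<omega>) [1..<Suc n] = xs} \<in> sets (F n)"
  proof (cases "length xs = n")
    case True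
    have hist: "map (\<lambda>m. X m \<omega>) [1..<Suc n] = map (\<lambda>i. X (Suc i) \<omega>) [0..<n]" for \<omega>
      unfolding One_nat_def map_Suc_upt[symmetric] by simp
    have "{\<omega>\<in>space M. map (\<lambda>m. X m \<omega>) [1..<Suc n] = xs}
        = {\<omega>\<in>space M. \<forall>i<n. X (Suc i) \<omega> = xs ! i}"
      unfolding hist using True by (simp add: list_eq_iff_nth_eq)
    also have "\<dots> = (\<Inter>i\<in>{..<n}. {\<omega>\<in>space M. X (Suc i) \<omega> = xs ! i})"
      using n by (auto simp: Suc_le_eq)
    finally have "{\<omega>\<in>space M. map (\<lambda>m. X m \<omega>) [1..<Suc n] = xs}
        = (\<Inter>i\<in>{..<n}. {\<omega>\<in>space M. X (Suc i) \<omega> = xs ! i})" .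
    then show ?thesis
      using n by (simp only:) (intro Fn.finite_INT X_level_set, auto simp: lessThan_empty_iff)
  next
    case False
    then have "{\<omega>\<in>space M. map (\<lambda>m. X m \<omega>) [1..<Suc n] = xs} = {}" by auto
    then show ?thesis by (simp only: Fn.empty_sets)
  qed
  ultimately have "{\<omega>\<in>space M. map (\<lambda>m. X m \<omega>) [1..<Suc n] = xs}
      \<inter> {\<omega>\<in>space M. min (\<tau> \<omega>) (Suc n) = r} \<in> sets (F n)" by blast
  then show ?thesis by (rule back_subst[where P = "\<lambda>A. A \<in> _"]) auto
qed

text \<open>Weak duality for general filtrations: take the pathwise inequality at
  \<open>\<rho> = \<tau> \<omega>\<close> and integrate. The static claims integrate to their cost
  because marginals are prescribed, the stock gains to zero.\<close>

lemma expected_payoff_le_cost: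
  assumes \<tau>: "is_stopping_time N M F \<tau>" and sup: "super_replicates N t J x a b \<Theta>1 \<Theta>2"
  shows "(\<integral>\<omega>. a (X (\<tau> \<omega>) \<omega>) (t (\<tau> \<omega>)) \<partial>M) \<le> strat_cost N J p b"
proof -
  have \<tau>N: "\<tau> \<omega> \<in> {1..N}" if "\<omega> \<in> space M" for \<omega>
    using \<tau> that by (auto simp: is_stopping_time_def)
  define st where "st \<omega> = (\<Sum>n=1..N. \<Sum>j\<le>J. b j n * (if X n \<omega> = x j then 1 else 0))" for \<omega>
  define K where "K n \<omega> = (map (\<lambda>m. X m \<omega>) [1..<Suc n], min (\<tau> \<omega>) (Suc n))" for n \<omega>
  \<comment> \<open>\<open>n < r\<close> means that exercise lies after time \<open>n\<close>;
    otherwise \<open>r\<close> is the actual exercise time, as \<open>\<Theta>2\<close>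
    requires.\<close>
  define z where "z n = (\<lambda>(xs, r). if n < r then \<Theta>1 n xs else \<Theta>2 n xs r)" for n
  define G where "G n \<omega> = z n (K n \<omega>) * (X (Suc n) \<omega> - X n \<omega>)" for n \<omega>
  have gain: "gainT N J x b \<Theta>1 \<Theta>2 (\<lambda>n. X n \<omega>) (\<tau> \<omega>) = st \<omega> + (\<Sum>n\<in>{1..<N}. G n \<omega>)"
    if "\<omega> \<in> space M" for \<omega>
  proof -
    have "(\<Sum>n\<in>{1..<N}. G n \<omega>) = (\<Sum>n\<in>{1..<\<tau> \<omega>}. G n \<omega>) + (\<Sum>n\<in>{\<tau> \<omega>..<N}. G n \<omega>)"
      using \<tau>N[OF that] by (simp add: sum.atLeastLessThan_concat)
    moreover have "(\<Sum>n\<in>{1..<\<tau> \<omega>}. G n \<omega>)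
        = (\<Sum>n\<in>{1..<\<tau> \<omega>}. \<Theta>1 n (map (\<lambda>n. X n \<omega>) [1..<Suc n]) * (X (Suc n) \<omega> - X n \<omega>))"
      by (intro sum.cong) (auto simp: G_def z_def K_def)
    moreover have "(\<Sum>n\<in>{\<tau> \<omega>..<N}. G n \<omega>)
        = (\<Sum>n\<in>{\<tau> \<omega>..<N}. \<Theta>2 n (map (\<lambda>n. X n \<omega>) [1..<Suc n]) (\<tau> \<omega>) * (X (Suc n) \<omega> - X n \<omega>))"
      by (intro sum.cong) (auto simp: G_def z_def K_def min_def)
    ultimately show ?thesis by (simp add: gainT_def st_def)
  qed
  have G: "integrable M (G n)" "(\<integral>\<omega>. G n \<omega> \<partial>M) = 0" if "n \<in> {1..<N}" for n
  proof -
    define S where "S = {xs. set xs \<subseteq> x ` {0..J} \<and> length xs = n} \<times> {..Suc n}"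
    have "finite S" unfolding S_def by (intro finite_cartesian_product finite_lists_length_eq) auto
    moreover have "K n \<omega> \<in> S" if "\<omega> \<in> space M" for \<omega>
      using X_lattice[OF _ _ that] \<open>n \<in> {1..<N}\<close> by (auto simp: K_def S_def)
    moreover have "{\<omega>\<in>space M. K n \<omega> = s} \<in> sets (F n)" for s
      unfolding K_def using stopped_history_measurable[OF _ _ \<tau>, of n "fst s" "snd s"] that by simp
    ultimately show "integrable M (G n)" "(\<integral>\<omega>. G n \<omega> \<partial>M) = 0"
      unfolding G_def using that integral_predictable_increment[of n S "K n" "z n"] by auto
  qed
  have st_eq: "st \<omega> = (\<Sum>n=1..N. \<Sum>j\<le>J. b j n * indicator {\<omega>\<in>space M. X n \<omega> = x j} \<omega>)"
    if "\<omega> \<in> space M" for \<omega>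
    using that unfolding st_def by (intro sum.cong refl) (auto simp: indicator_def)
  have level: "{\<omega>\<in>space M. X n \<omega> = x j} \<in> sets M" if "n \<in> {1..N}" for n j
    using that by (intro sets_F[OF _ X_level_set[of n n]]) auto
  have int_ind: "integrable M (indicator {\<omega>\<in>space M. X n \<omega> = x j} :: _ \<Rightarrow> real)"
    if "n \<in> {1..N}" for n j
    using level[OF that] by (simp add: integrable_indicator_iff less_top[symmetric])
  have st: "integrable M st" "(\<integral>\<omega>. st \<omega> \<partial>M) = strat_cost N J p b"
  proof -
    show "integrable M st"
      by (subst Bochner_Integration.integrable_cong[OF refl st_eq], assumption)
        (intro Bochner_Integration.integrable_sum integrable_mult_right int_ind)
    have "(\<integral>\<omega>. st \<omega> \<partial>M)
        = (\<integral>\<omega>. (\<Sum>n=1..N. \<Sum>j\<le>J. b j n * indicator {\<omega>\<in>space M. X n \<omega> = x j} \<omega>) \<partial>M)"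
      by (intro Bochner_Integration.integral_cong refl st_eq)
    also have "\<dots> = (\<Sum>n=1..N. \<integral>\<omega>. (\<Sum>j\<le>J. b j n * indicator {\<omega>\<in>space M. X n \<omega> = x j} \<omega>) \<partial>M)"
      by (intro Bochner_Integration.integral_sum Bochner_Integration.integrable_sum
          integrable_mult_right int_ind)
    also have "\<dots> = (\<Sum>n=1..N. \<Sum>j\<le>J. \<integral>\<omega>. b j n * indicator {\<omega>\<in>space M. X n \<omega> = x j} \<omega> \<partial>M)"
      by (intro sum.cong refl Bochner_Integration.integral_sum integrable_mult_right int_ind)
    also have "\<dots> = (\<Sum>n=1..N. \<Sum>j\<le>J. b j n * measure M {\<omega>\<in>space M. X n \<omega> = x j})"
    proof (intro sum.cong refl)
      fix n j
      have "{\<omega>\<in>space M. X n \<omega> = x j} \<inter> space M = {\<omega>\<in>space M. X n \<omega> = x j}" by auto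
      then show "(\<integral>\<omega>. b j n * indicator {\<omega>\<in>space M. X n \<omega> = x j} \<omega> \<partial>M)
          = b j n * measure M {\<omega>\<in>space M. X n \<omega> = x j}" by simp
    qed
    also have "\<dots> = strat_cost N J p b"
      unfolding strat_cost_def using X_marginal by (intro sum.cong refl) auto
    finally show "(\<integral>\<omega>. st \<omega> \<partial>M) = strat_cost N J p b" .
  qed
  have "integrable M (\<lambda>\<omega>. (\<lambda>(n, y). a y (t n)) (\<tau> \<omega>, X (\<tau> \<omega>) \<omega>) * 1)"
  proof (rule integral_finite_valued(1)[where K = "\<lambda>\<omega>. (\<tau> \<omega>, X (\<tau> \<omega>) \<omega>)" and z = "\<lambda>(n, y). a y (t n)"])
    show "finite ({1..N} \<times> x ` {0..J})" by simp
    show "(\<tau> \<omega>, X (\<tau> \<omega>) \<omega>) \<in> {1..N} \<times> x ` {0..J}" if "\<omega> \<in> space M" for \<omega>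
      using \<tau>N[OF that] X_lattice[OF _ _ that, of "\<tau> \<omega>"] by auto
    fix s assume s: "s \<in> {1..N} \<times> x ` {0..J}"
    have "{\<omega>\<in>space M. \<tau> \<omega> = fst s} \<in> sets M"
      using s \<tau> by (intro sets_F[of "fst s"]) (auto simp: is_stopping_time_def)
    moreover have "{\<omega>\<in>space M. X (fst s) \<omega> = snd s} \<in> sets M"
      using s by (intro sets_F[OF _ X_level_set[of "fst s" "fst s"]]) auto
    ultimately have "{\<omega>\<in>space M. \<tau> \<omega> = fst s} \<inter> {\<omega>\<in>space M. X (fst s) \<omega> = snd s} \<in> sets M"
      by blast
    then show "{\<omega>\<in>space M. (\<tau> \<omega>, X (\<tau> \<omega>) \<omega>) = s} \<in> sets M"
      by (rule back_subst[where P = "\<lambda>A. A \<in> _"]) (auto simp: prod_eq_iff)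
  qed simp
  then have int_a: "integrable M (\<lambda>\<omega>. a (X (\<tau> \<omega>) \<omega>) (t (\<tau> \<omega>)))" by simp
  have "(\<integral>\<omega>. a (X (\<tau> \<omega>) \<omega>) (t (\<tau> \<omega>)) \<partial>M) \<le> (\<integral>\<omega>. st \<omega> + (\<Sum>n\<in>{1..<N}. G n \<omega>) \<partial>M)"
  proof (rule integral_mono[OF int_a])
    show "integrable M (\<lambda>\<omega>. st \<omega> + (\<Sum>n\<in>{1..<N}. G n \<omega>))"
      using st G by (intro Bochner_Integration.integrable_add Bochner_Integration.integrable_sum)
    show "a (X (\<tau> \<omega>) \<omega>) (t (\<tau> \<omega>)) \<le> st \<omega> + (\<Sum>n\<in>{1..<N}. G n \<omega>)" if "\<omega> \<in> space M" for \<omega>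
    proof -
      have "\<forall>n\<in>{1..N}. X n \<omega> \<in> x ` {0..J}" using X_lattice[OF _ _ that] by simp
      then have "a (X (\<tau> \<omega>) \<omega>) (t (\<tau> \<omega>)) \<le> gainT N J x b \<Theta>1 \<Theta>2 (\<lambda>n. X n \<omega>) (\<tau> \<omega>)"
        using sup[unfolded super_replicates_def, rule_format, of "\<lambda>n. X n \<omega>" "\<tau> \<omega>"] \<tau>N[OF that] by simp
      then show ?thesis using gain[OF that] by simp
    qed
  qed
  also have "\<dots> = (\<integral>\<omega>. st \<omega> \<partial>M) + (\<Sum>n\<in>{1..<N}. \<integral>\<omega>. G n \<omega> \<partial>M)"
  proof -
    have "integrable M (\<lambda>\<omega>. \<Sum>n\<in>{1..<N}. G n \<omega>)"
      using G by (intro Bochner_Integration.integrable_sum)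
    moreover have "(\<integral>\<omega>. (\<Sum>n\<in>{1..<N}. G n \<omega>) \<partial>M) = (\<Sum>n\<in>{1..<N}. \<integral>\<omega>. G n \<omega> \<partial>M)"
      using G by (intro Bochner_Integration.integral_sum)
    ultimately show ?thesis using st by simp
  qed
  also have "\<dots> = strat_cost N J p b"
    using st G by simp
  finally show ?thesis .
qed

end

text \<open>\<open>cSup_least\<close> needs a candidate; exercising at time index 1 is one.\<close>

lemma payoff_set_nonempty:
  assumes "N \<ge> 1" and model: "is_model N J x s0 p M F X"
  shows "{(\<integral>\<omega>. a (X (\<tau> \<omega>) \<omega>) (t (\<tau> \<omega>)) \<partial>M) | \<tau>. is_stopping_time N M F \<tau>} \<noteq> {}"
proof -
  have "space (F 1) = space M"
    using assms by (simp add: is_model_def)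
  then have "{\<omega>\<in>space M. 1 = n} \<in> sets (F n)" for n
    using sets.top[of "F 1"] by (cases "n = 1") auto
  moreover have "1 \<in> {1..N}" using \<open>N \<ge> 1\<close> by simp
  ultimately have "is_stopping_time N M F (\<lambda>_. 1)"
    unfolding is_stopping_time_def by (intro conjI ballI)
  then show ?thesis by blast
qed

text \<open>The cost of a single super-replicating strategy bounds all stopping times at once; this
  makes \<open>phi\<close> a genuine supremum, so that \<open>cSup_upper\<close> applies.\<close>

lemma payoff_set_bdd_above:
  assumes model: "is_model N J x s0 p M F X" and sup: "super_replicates N t J x a b \<Theta>1 \<Theta>2"
  shows "bdd_above {(\<integral>\<omega>. a (X (\<tau> \<omega>) \<omega>) (t (\<tau> \<omega>)) \<partial>M) | \<tau>. is_stopping_time N M F \<tau>}"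
proof -
  interpret prob_space M using model by (simp add: is_model_def)
  interpret lattice_model M N J x s0 p F X using model by unfold_locales
  show ?thesis using expected_payoff_le_cost[OF _ sup] by (intro bdd_aboveI[of _ "strat_cost N J p b"]) auto
qed

lemma phi_le_strat_cost:
  assumes "N \<ge> 1" and model: "is_model N J x s0 p M F X"
    and sup: "super_replicates N t J x a b \<Theta>1 \<Theta>2"
  shows "phi N t a M F X \<le> strat_cost N J p b"
proof -
  interpret prob_space M using model by (simp add: is_model_def)
  interpret lattice_model M N J x s0 p F X using model by unfold_locales
  show ?thesis unfolding phi_def
    using expected_payoff_le_cost[OF _ sup]
    by (intro cSup_least[OF payoff_set_nonempty[OF assms(1,2)]]) auto
qed

text \<open>Each trading period is paid for by its own claims \<open>e1\<close> at its start and
  \<open>e2\<close> at its end. By (ii) a period before exercise does not lose; by (iii) a period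
  after exercise earns at least the drop of \<open>v\<close>. These drops telescope from
  \<open>\<rho>\<close> to \<open>N\<close>, and with the final claim \<open>v\<close> at
  \<open>N\<close> they leave \<open>v\<close> at \<open>\<rho>\<close>, which dominates the
  payoff.\<close>

lemma markov_strategy_super_replicates:
  assumes inj: "inj_on x {..J}" and N: "N \<ge> 1"
    and dual: "dual_feasible N t J x a e1 e2 v d1 d2"
  shows "super_replicates N t J x a (markov_b N e1 e2 v) (markov_theta1 J x d1) (markov_theta2 J x d2)"
  unfolding super_replicates_def
proof (intro allI impI ballI)
  fix xp \<rho> assume path: "\<forall>n\<in>{1..N}. xp n \<in> x ` {0..J}" and \<rho>: "\<rho> \<in> {1..N}"
  from path have "\<forall>n\<in>{1..N}. \<exists>j\<le>J. xp n = x j"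
    by (metis atLeastAtMost_iff imageE)
  then obtain i where i: "\<And>n. n \<in> {1..N} \<Longrightarrow> i n \<le> J \<and> xp n = x (i n)" by metis
  have pick: "(\<Sum>j\<le>J. if xp n = x j then h j else 0) = h (i n)" if "n \<in> {1..N}" for n and h :: "nat \<Rightarrow> real"
  proof -
    have "(\<Sum>j\<le>J. if xp n = x j then h j else 0) = (\<Sum>j\<le>J. if j = i n then h j else 0)"
      using i[OF that] inj by (intro sum.cong) (auto simp: inj_on_def)
    then show ?thesis using i[OF that] by simp
  qed
  let ?D = "\<lambda>n. x (i (Suc n)) - x (i n)"
  have th: "markov_theta1 J x d1 n (map xp [1..<Suc n]) * (xp (Suc n) - xp n) = d1 (i n) n * ?D n"
    "markov_theta2 J x d2 n (map xp [1..<Suc n]) r * (xp (Suc n) - xp n) = d2 (i n) n * ?D n"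
    if "n \<in> {1..<N}" for n r
  proof -
    have "last (map xp [1..<Suc n]) = xp n" using that by (simp add: last_map)
    then show "markov_theta1 J x d1 n (map xp [1..<Suc n]) * (xp (Suc n) - xp n) = d1 (i n) n * ?D n"
      "markov_theta2 J x d2 n (map xp [1..<Suc n]) r * (xp (Suc n) - xp n) = d2 (i n) n * ?D n"
      using that i[of n] i[of "Suc n"] pick[of n]
      unfolding markov_theta1_def markov_theta2_def by auto
  qed
  \<comment> \<open>Regrouping by trading period shifts \<open>e2\<close> by one index; the leftover
    boundary terms are \<open>e1\<close> at \<open>N\<close> and \<open>e2\<close> at 1, both zero
    by feasibility.\<close>
  have static: "(\<Sum>n=1..N. \<Sum>j\<le>J. markov_b N e1 e2 v j n * (if xp n = x j then 1 else 0))
      = (\<Sum>n\<in>{1..<N}. e1 (i n) n + e2 (i (Suc n)) (Suc n)) + v (i N) N"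
  proof -
    have "(\<Sum>n=1..N. \<Sum>j\<le>J. markov_b N e1 e2 v j n * (if xp n = x j then 1 else 0))
        = (\<Sum>n=1..N. markov_b N e1 e2 v (i n) n)"
      using pick by (intro sum.cong refl) (simp add: if_distrib[of "(*) _"] cong: if_cong)
    also have "\<dots> = (\<Sum>n=1..N. e1 (i n) n) + (\<Sum>n=1..N. e2 (i n) n)
        + (\<Sum>n=1..N. if n = N then v (i n) n else 0)"
      unfolding markov_b_def sum.distrib[symmetric] by (intro sum.cong) auto
    also have "(\<Sum>n=1..N. if n = N then v (i n) n else 0) = v (i N) N"
      using N by simp
    also have "(\<Sum>n=1..N. e1 (i n) n) = (\<Sum>n\<in>{1..<N}. e1 (i n) n)"
    proof -
      have "{1..N} = insert N {1..<N}" using N by auto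
      then show ?thesis using dual i[of N] N by (simp add: dual_feasible_def)
    qed
    also have "(\<Sum>n=1..N. e2 (i n) n) = (\<Sum>n\<in>{1..<N}. e2 (i (Suc n)) (Suc n))"
    proof -
      have "(\<Sum>n=1..N. e2 (i n) n) = e2 (i 1) 1 + (\<Sum>n=Suc 1..N. e2 (i n) n)"
        using N by (rule sum.atLeast_Suc_atMost)
      moreover have "(\<Sum>n=Suc 1..N. e2 (i n) n) = (\<Sum>n\<in>{1..<N}. e2 (i (Suc n)) (Suc n))"
        unfolding atLeastLessThanSuc_atLeastAtMost[symmetric] by (rule sum.shift_bounds_Suc_ivl)
      ultimately show ?thesis using dual i[of 1] N by (simp add: dual_feasible_def)
    qed
    finally show ?thesis by (simp add: sum.distrib)
  qed
  let ?E = "\<lambda>n. e1 (i n) n + e2 (i (Suc n)) (Suc n)"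
  have split: "(\<Sum>n\<in>{1..<N}. ?E n) = (\<Sum>n\<in>{1..<\<rho>}. ?E n) + (\<Sum>n\<in>{\<rho>..<N}. ?E n)"
    using \<rho> by (simp add: sum.atLeastLessThan_concat)
  have "(\<Sum>n\<in>{1..<\<rho>}. markov_theta1 J x d1 n (map xp [1..<Suc n]) * (xp (Suc n) - xp n))
      = (\<Sum>n\<in>{1..<\<rho>}. d1 (i n) n * ?D n)"
    using \<rho> by (intro sum.cong refl th) auto
  moreover have "(\<Sum>n\<in>{\<rho>..<N}. markov_theta2 J x d2 n (map xp [1..<Suc n]) \<rho> * (xp (Suc n) - xp n))
      = (\<Sum>n\<in>{\<rho>..<N}. d2 (i n) n * ?D n)"
    using \<rho> by (intro sum.cong refl th) auto
  ultimately have "gainT N J x (markov_b N e1 e2 v) (markov_theta1 J x d1) (markov_theta2 J x d2) xp \<rho>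
      = (\<Sum>n\<in>{1..<\<rho>}. ?E n + d1 (i n) n * ?D n) + (\<Sum>n\<in>{\<rho>..<N}. ?E n + d2 (i n) n * ?D n)
        + v (i N) N"
    unfolding gainT_def static split sum.distrib[of _ "\<lambda>n. d1 (i n) n * ?D n"]
      sum.distrib[of _ "\<lambda>n. d2 (i n) n * ?D n"] by linarith
  moreover have "(\<Sum>n\<in>{1..<\<rho>}. ?E n + d1 (i n) n * ?D n) \<ge> 0"
    using dual \<rho> i by (intro sum_nonneg) (auto simp: dual_feasible_def mult.commute)
  moreover have "(\<Sum>n\<in>{\<rho>..<N}. ?E n + d2 (i n) n * ?D n)
      \<ge> (\<Sum>n\<in>{\<rho>..<N}. v (i n) n - v (i (Suc n)) (Suc n))"
  proof (rule sum_mono)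
    fix n assume n: "n \<in> {\<rho>..<N}"
    then have "e1 (i n) n + e2 (i (Suc n)) (Suc n) + ?D n * d2 (i n) n - v (i n) n + v (i (Suc n)) (Suc n) \<ge> 0"
      using dual \<rho> i[of n] i[of "Suc n"] by (auto simp: dual_feasible_def)
    then show "v (i n) n - v (i (Suc n)) (Suc n) \<le> ?E n + d2 (i n) n * ?D n"
      by (simp add: mult.commute)
  qed
  moreover have "(\<Sum>n\<in>{\<rho>..<N}. v (i n) n - v (i (Suc n)) (Suc n)) = v (i \<rho>) \<rho> - v (i N) N"
    using \<rho> sum_Suc_diff'[of \<rho> N "\<lambda>n. - v (i n) n"] by simp
  moreover have "v (i \<rho>) \<rho> \<ge> a (xp \<rho>) (t \<rho>)"
    using dual \<rho> i[OF \<rho>] by (simp add: dual_feasible_def)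
  ultimately show "a (xp \<rho>) (t \<rho>)
      \<le> gainT N J x (markov_b N e1 e2 v) (markov_theta1 J x d1) (markov_theta2 J x d2) xp \<rho>"
    by linarith
qed

lemma markov_strategy_cost:
  assumes "N \<ge> 1"
  shows "strat_cost N J p (markov_b N e1 e2 v)
    = (\<Sum>n=1..N. \<Sum>j\<le>J. (e1 j n + e2 j n) * p j n) + (\<Sum>j\<le>J. v j N * p j N)"
proof -
  have "strat_cost N J p (markov_b N e1 e2 v)
      = (\<Sum>n=1..N. (\<Sum>j\<le>J. (e1 j n + e2 j n) * p j n) + (if n = N then \<Sum>j\<le>J. v j n * p j n else 0))"
    unfolding strat_cost_def markov_b_def
    by (intro sum.cong refl) (auto simp: sum.distrib[symmetric] algebra_simps intro!: sum.cong)
  then show ?thesis using assms by (simp add: sum.distrib)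
qed

subsection \<open>Finite Markov chains as path measures\<close>

locale finite_markov_chain =
  fixes S :: "'b set" and K :: "nat \<Rightarrow> 'b \<Rightarrow> 'b \<Rightarrow> real" and init :: 'b and N :: nat
  assumes finite_S: "finite S" and init_S: "init \<in> S"
    and K_nonneg: "\<And>n s s'. n < N \<Longrightarrow> s \<in> S \<Longrightarrow> s' \<in> S \<Longrightarrow> K n s s' \<ge> 0"
    and K_sum: "\<And>n s. n < N \<Longrightarrow> s \<in> S \<Longrightarrow> (\<Sum>s'\<in>S. K n s s') = 1"
begin

definition paths :: "nat \<Rightarrow> 'b list set" where
  "paths n = {\<omega>. set \<omega> \<subseteq> S \<and> length \<omega> = Suc n}"

text \<open>The product is taken over the length of the list instead of up to \<open>N\<close>, so
  the same function also gives the law of every prefix.\<close>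

definition weight :: "'b list \<Rightarrow> real" where
  "weight \<omega> = of_bool (\<omega> ! 0 = init) * (\<Prod>i<length \<omega> - 1. K i (\<omega> ! i) (\<omega> ! Suc i))"

text \<open>Discarding the null paths makes pathwise properties of the support hold on the whole space.\<close>

definition chain_space :: "'b list set" where
  "chain_space = {\<omega>\<in>paths N. weight \<omega> \<noteq> 0}"

definition chain :: "'b list measure" where
  "chain = point_measure chain_space (\<lambda>\<omega>. ennreal (weight \<omega>))"

text \<open>Generated by whole states rather than prices, so that the regime is adapted. Times start
  at 0, hence a prefix of length \<open>Suc n\<close>.\<close>

definition history :: "nat \<Rightarrow> 'b list measure" where
  "history n = vimage_algebra chain_space (take (Suc n)) (count_space UNIV)"

lemma finite_paths: "finite (paths n)"
  unfolding paths_def using finite_lists_length_eq[OF finite_S, of "Suc n"] by simp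

lemma paths_nth: "\<omega> \<in> paths n \<Longrightarrow> m \<le> n \<Longrightarrow> \<omega> ! m \<in> S"
  unfolding paths_def by (auto simp: subset_iff)

lemma weight_nonneg: "\<omega> \<in> paths N \<Longrightarrow> weight \<omega> \<ge> 0"
  unfolding weight_def
  by (intro mult_nonneg_nonneg prod_nonneg ballI K_nonneg paths_nth[of \<omega> N]) (auto simp: paths_def)

lemma sum_paths_Suc:
  "(\<Sum>\<omega>\<in>paths (Suc n). f \<omega>) = (\<Sum>\<omega>\<in>paths n. \<Sum>s\<in>S. f (\<omega> @ [s]))" for f :: "'b list \<Rightarrow> real"
proof -
  have "(\<Sum>\<omega>\<in>paths n. \<Sum>s\<in>S. f (\<omega> @ [s])) = (\<Sum>(\<omega>, s)\<in>paths n \<times> S. f (\<omega> @ [s]))"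
    by (rule sum.cartesian_product)
  also have "\<dots> = (\<Sum>\<omega>\<in>paths (Suc n). f \<omega>)"
  proof (rule sum.reindex_bij_witness[where i = "\<lambda>\<omega>. (butlast \<omega>, last \<omega>)" and j = "\<lambda>(\<omega>, s). \<omega> @ [s]"])
    fix \<omega> assume \<omega>: "\<omega> \<in> paths (Suc n)"
    then have "\<omega> \<noteq> []" by (auto simp: paths_def)
    then show "(butlast \<omega>, last \<omega>) \<in> paths n \<times> S"
      using \<omega> by (auto simp: paths_def dest: in_set_butlastD)
    show "(case (butlast \<omega>, last \<omega>) of (\<omega>, s) \<Rightarrow> \<omega> @ [s]) = \<omega>" using \<open>\<omega> \<noteq> []\<close> by simp
  qed (auto simp: paths_def)
  finally show ?thesis by simp
qed

lemma weight_snoc: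
  assumes "\<omega> \<in> paths n"
  shows "weight (\<omega> @ [s]) = weight \<omega> * K n (\<omega> ! n) s"
proof -
  have len: "length \<omega> = Suc n" using assms by (simp add: paths_def)
  have "(\<Prod>i<n. K i ((\<omega> @ [s]) ! i) ((\<omega> @ [s]) ! Suc i)) = (\<Prod>i<n. K i (\<omega> ! i) (\<omega> ! Suc i))"
    using len by (intro prod.cong) (auto simp: nth_append)
  then show ?thesis using len by (simp add: weight_def nth_append)
qed

text \<open>Consistency of the path laws: the kernel rows sum to 1, so the last states can be summed
  out one at a time.\<close>

lemma sum_weight_take:
  fixes g :: "'b list \<Rightarrow> real"
  assumes "n \<le> m" "m \<le> N"
  shows "(\<Sum>\<omega>\<in>paths m. weight \<omega> * g (take (Suc n) \<omega>)) = (\<Sum>\<omega>\<in>paths n. weight \<omega> * g \<omega>)"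
  using assms
proof (induction m rule: dec_induct)
  case base
  show ?case by (intro sum.cong) (auto simp: paths_def)
next
  case (step m)
  have "(\<Sum>\<omega>\<in>paths (Suc m). weight \<omega> * g (take (Suc n) \<omega>))
      = (\<Sum>\<omega>\<in>paths m. \<Sum>s\<in>S. weight \<omega> * g (take (Suc n) \<omega>) * K m (\<omega> ! m) s)"
    unfolding sum_paths_Suc using step.hyps
    by (intro sum.cong refl) (auto simp: weight_snoc paths_def)
  also have "\<dots> = (\<Sum>\<omega>\<in>paths m. weight \<omega> * g (take (Suc n) \<omega>))"
    unfolding sum_distrib_left[symmetric] using step.prems K_sum[of m] paths_nth[of _ m m]
    by (intro sum.cong refl) auto
  finally show ?case using step by simp
qed

lemma space_chain [simp]: "space chain = chain_space"
  by (simp add: chain_def space_point_measure)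

lemma sets_chain [simp]: "sets chain = Pow chain_space"
  by (simp add: chain_def sets_point_measure)

lemma chain_space_paths: "chain_space \<subseteq> paths N"
  by (auto simp: chain_space_def)

lemma finite_chain_space: "finite chain_space"
  using chain_space_paths finite_paths finite_subset by blast

lemma integral_chain:
  fixes f :: "'b list \<Rightarrow> real"
  shows "(\<integral>\<omega>. f \<omega> \<partial>chain) = (\<Sum>\<omega>\<in>paths N. weight \<omega> * f \<omega>)"
proof -
  have "(\<integral>\<omega>. f \<omega> \<partial>chain) = (\<Sum>\<omega>\<in>chain_space. weight \<omega> * f \<omega>)"
    unfolding chain_def using finite_chain_space weight_nonneg chain_space_paths
    by (subst lebesgue_integral_point_measure_finite) auto
  also have "\<dots> = (\<Sum>\<omega>\<in>paths N. weight \<omega> * f \<omega>)"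
    by (rule sum.mono_neutral_left[OF finite_paths]) (auto simp: chain_space_def)
  finally show ?thesis .
qed

lemma integral_chain_take:
  fixes g :: "'b list \<Rightarrow> real"
  assumes "n \<le> N"
  shows "(\<integral>\<omega>. g (take (Suc n) \<omega>) \<partial>chain) = (\<Sum>\<omega>\<in>paths n. weight \<omega> * g \<omega>)"
  unfolding integral_chain using sum_weight_take[OF assms order_refl] .

lemma integral_chain_init: "(\<integral>\<omega>. \<phi> (\<omega> ! 0) \<partial>chain) = \<phi> init" for \<phi> :: "'b \<Rightarrow> real"
proof -
  have paths0: "paths 0 = (\<lambda>s. [s]) ` S"
    by (auto simp: paths_def length_Suc_conv)
  have "(\<integral>\<omega>. \<phi> (\<omega> ! 0) \<partial>chain) = (\<integral>\<omega>. \<phi> (take (Suc 0) \<omega> ! 0) \<partial>chain)"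
    by (intro Bochner_Integration.integral_cong refl) simp
  also have "\<dots> = (\<Sum>\<omega>\<in>paths 0. weight \<omega> * \<phi> (\<omega> ! 0))"
    by (rule integral_chain_take) simp
  also have "\<dots> = (\<Sum>s\<in>S. if s = init then \<phi> s else 0)"
    unfolding paths0 by (subst sum.reindex) (auto simp: inj_on_def weight_def intro!: sum.cong)
  finally show ?thesis using finite_S init_S by simp
qed

lemma prob_space_chain: "prob_space chain"
proof
  have "emeasure chain (space chain) = (\<Sum>\<omega>\<in>chain_space. ennreal (weight \<omega>))"
    unfolding chain_def using finite_chain_space
    by (subst emeasure_point_measure_finite) (auto simp: space_point_measure)
  also have "\<dots> = ennreal (\<Sum>\<omega>\<in>chain_space. weight \<omega>)"
    using weight_nonneg chain_space_paths by (intro sum_ennreal) auto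
  also have "(\<Sum>\<omega>\<in>chain_space. weight \<omega>) = (\<Sum>\<omega>\<in>paths N. weight \<omega> * 1)"
    by (simp, rule sum.mono_neutral_left[OF finite_paths]) (auto simp: chain_space_def)
  also have "\<dots> = 1"
    using integral_chain_init[of "\<lambda>_. 1"] unfolding integral_chain .
  finally show "emeasure chain (space chain) = 1" by simp
qed

lemma measure_chain:
  "measure chain (A \<inter> {\<omega>\<in>space chain. P \<omega>}) = (\<integral>\<omega>. indicator A \<omega> * of_bool (P \<omega>) \<partial>chain)"
proof -
  have "(\<integral>\<omega>. indicator A \<omega> * (of_bool (P \<omega>) :: real) \<partial>chain) = (\<integral>\<omega>. indicator (A \<inter> {\<omega>\<in>space chain. P \<omega>}) \<omega> \<partial>chain)"
    by (intro Bochner_Integration.integral_cong refl) (auto simp: indicator_def)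
  also have "\<dots> = measure chain (A \<inter> {\<omega>\<in>space chain. P \<omega>} \<inter> space chain)"
    by (rule Bochner_Integration.integral_indicator)
  also have "A \<inter> {\<omega>\<in>space chain. P \<omega>} \<inter> space chain = A \<inter> {\<omega>\<in>space chain. P \<omega>}" by auto
  finally show ?thesis by simp
qed

lemma measure_chain_Collect:
  "measure chain {\<omega>\<in>space chain. P \<omega>} = (\<integral>\<omega>. of_bool (P \<omega>) \<partial>chain)"
proof -
  have "measure chain {\<omega>\<in>space chain. P \<omega>} = measure chain (chain_space \<inter> {\<omega>\<in>space chain. P \<omega>})"
    by (rule arg_cong[where f = "measure chain"]) auto
  also have "\<dots> = (\<integral>\<omega>. indicator chain_space \<omega> * of_bool (P \<omega>) \<partial>chain)"
    by (rule measure_chain)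
  also have "\<dots> = (\<integral>\<omega>. of_bool (P \<omega>) \<partial>chain)"
    by (intro Bochner_Integration.integral_cong refl) simp
  finally show ?thesis .
qed

lemma space_history [simp]: "space (history n) = chain_space"
  by (simp add: history_def)

lemma sets_history: "sets (history n) = {take (Suc n) -` B \<inter> chain_space | B. True}"
  unfolding history_def by (subst sets_vimage_algebra2) auto

lemma sets_history_mono:
  assumes "m \<le> n"
  shows "sets (history m) \<subseteq> sets (history n)"
proof
  fix A assume "A \<in> sets (history m)"
  then obtain B where "A = take (Suc m) -` B \<inter> chain_space" by (auto simp: sets_history)
  then have "A = take (Suc n) -` (take (Suc m) -` B) \<inter> chain_space"
    using assms by (auto simp: min_def)
  then show "A \<in> sets (history n)" by (auto simp: sets_history)
qed

lemma history_Collect: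
  assumes "\<And>\<omega>. \<omega> \<in> chain_space \<Longrightarrow> P \<omega> \<longleftrightarrow> Q (take (Suc n) \<omega>)"
  shows "{\<omega>\<in>chain_space. P \<omega>} \<in> sets (history n)"
proof -
  have "{\<omega>\<in>chain_space. P \<omega>} = take (Suc n) -` Collect Q \<inter> chain_space" using assms by auto
  then show ?thesis unfolding sets_history by blast
qed

lemma state_measurable:
  assumes "\<And>s. \<phi> s \<in> space M'"
  shows "(\<lambda>\<omega>. \<phi> (\<omega> ! n)) \<in> measurable (history n) M'"
proof -
  have "(\<lambda>\<omega>. \<phi> (take (Suc n) \<omega> ! n)) \<in> measurable (history n) M'"
    using assms unfolding history_def
    by (intro measurable_compose[OF measurable_vimage_algebra1, of "take (Suc n)" chain_space "count_space UNIV" "\<lambda>l. \<phi> (l ! n)"]) auto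
  then show ?thesis by simp
qed

text \<open>The Markov property in integrated form. \<open>A\<close> depends only on the prefix, so
  summing out the last state leaves the kernel average at the current one. The martingale property
  and both conditional laws of the regime model are derived from it.\<close>

lemma integral_one_step:
  fixes \<phi> :: "'b \<Rightarrow> real"
  assumes n: "n < N" and A: "A \<in> sets (history n)"
  shows "(\<integral>\<omega>. indicator A \<omega> * \<phi> (\<omega> ! Suc n) \<partial>chain)
    = (\<integral>\<omega>. indicator A \<omega> * (\<Sum>s\<in>S. K n (\<omega> ! n) s * \<phi> s) \<partial>chain)"
proof -
  obtain B where B: "A = take (Suc n) -` B \<inter> chain_space" using A by (auto simp: sets_history)
  have "(\<integral>\<omega>. indicator A \<omega> * \<phi> (\<omega> ! Suc n) \<partial>chain)
      = (\<integral>\<omega>. indicator B (take (Suc n) (take (Suc (Suc n)) \<omega>)) * \<phi> (take (Suc (Suc n)) \<omega> ! Suc n) \<partial>chain)"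
    by (intro Bochner_Integration.integral_cong refl) (auto simp: B indicator_def min_def)
  also have "\<dots> = (\<Sum>\<omega>\<in>paths (Suc n). weight \<omega> * (indicator B (take (Suc n) \<omega>) * \<phi> (\<omega> ! Suc n)))"
    using n by (intro integral_chain_take[where g = "\<lambda>\<omega>. indicator B (take (Suc n) \<omega>) * \<phi> (\<omega> ! Suc n)"]) simp
  also have "\<dots> = (\<Sum>\<omega>\<in>paths n. weight \<omega> * (indicator B \<omega> * (\<Sum>s\<in>S. K n (\<omega> ! n) s * \<phi> s)))"
    unfolding sum_paths_Suc sum_distrib_left
    by (intro sum.cong refl) (auto simp: weight_snoc paths_def nth_append)
  also have "\<dots> = (\<integral>\<omega>. indicator B (take (Suc n) \<omega>) * (\<Sum>s\<in>S. K n (take (Suc n) \<omega> ! n) s * \<phi> s) \<partial>chain)"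
    using n by (intro integral_chain_take[where g = "\<lambda>\<omega>. indicator B \<omega> * (\<Sum>s\<in>S. K n (\<omega> ! n) s * \<phi> s)", symmetric]) simp
  also have "\<dots> = (\<integral>\<omega>. indicator A \<omega> * (\<Sum>s\<in>S. K n (\<omega> ! n) s * \<phi> s) \<partial>chain)"
    by (intro Bochner_Integration.integral_cong refl) (auto simp: B indicator_def)
  finally show ?thesis .
qed

text \<open>A guessed family \<open>\<mu>\<close> of one-time laws has to be checked only against
  the forward equation.\<close>

lemma integral_marginal:
  fixes \<phi> :: "'b \<Rightarrow> real"
  assumes \<mu>0: "\<And>s. s \<in> S \<Longrightarrow> \<mu> 0 s = of_bool (s = init)"
    and \<mu>_Suc: "\<And>n s. n < N \<Longrightarrow> s \<in> S \<Longrightarrow> \<mu> (Suc n) s = (\<Sum>r\<in>S. \<mu> n r * K n r s)"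
    and "n \<le> N"
  shows "(\<integral>\<omega>. \<phi> (\<omega> ! n) \<partial>chain) = (\<Sum>s\<in>S. \<mu> n s * \<phi> s)"
  using \<open>n \<le> N\<close>
proof (induction n arbitrary: \<phi>)
  case 0
  have "(\<Sum>s\<in>S. \<mu> 0 s * \<phi> s) = (\<Sum>s\<in>S. if s = init then \<phi> s else 0)"
    using \<mu>0 by (intro sum.cong) auto
  then show ?case using integral_chain_init finite_S init_S by simp
next
  case (Suc n)
  have "chain_space \<in> sets (history n)" using sets.top[of "history n"] by simp
  from integral_one_step[OF _ this, of \<phi>] Suc.prems
  have "(\<integral>\<omega>. indicator chain_space \<omega> * \<phi> (\<omega> ! Suc n) \<partial>chain)
    = (\<integral>\<omega>. indicator chain_space \<omega> * (\<Sum>s\<in>S. K n (\<omega> ! n) s * \<phi> s) \<partial>chain)" by simp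
  moreover have "(\<integral>\<omega>. indicator chain_space \<omega> * f \<omega> \<partial>chain) = (\<integral>\<omega>. f \<omega> \<partial>chain)" for f :: "'b list \<Rightarrow> real"
    by (intro Bochner_Integration.integral_cong refl) simp
  ultimately have "(\<integral>\<omega>. \<phi> (\<omega> ! Suc n) \<partial>chain) = (\<integral>\<omega>. (\<Sum>s\<in>S. K n (\<omega> ! n) s * \<phi> s) \<partial>chain)"
    by simp
  also have "\<dots> = (\<Sum>r\<in>S. \<mu> n r * (\<Sum>s\<in>S. K n r s * \<phi> s))"
    using Suc.prems by (intro Suc.IH) simp
  also have "\<dots> = (\<Sum>s\<in>S. \<Sum>r\<in>S. \<mu> n r * (K n r s * \<phi> s))"
    unfolding sum_distrib_left by (rule sum.swap)
  also have "\<dots> = (\<Sum>s\<in>S. \<mu> (Suc n) s * \<phi> s)"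
    using Suc.prems by (intro sum.cong refl) (simp add: \<mu>_Suc sum_distrib_right mult.assoc)
  finally show ?case .
qed

lemma chain_space_nth: "\<omega> \<in> chain_space \<Longrightarrow> n \<le> N \<Longrightarrow> \<omega> ! n \<in> S"
  using chain_space_paths paths_nth by blast

lemma chain_space_init: "\<omega> \<in> chain_space \<Longrightarrow> \<omega> ! 0 = init"
  by (auto simp: chain_space_def weight_def)

lemma chain_space_step: "\<omega> \<in> chain_space \<Longrightarrow> n < N \<Longrightarrow> K n (\<omega> ! n) (\<omega> ! Suc n) \<noteq> 0"
  by (auto simp: chain_space_def weight_def paths_def)

end

subsection \<open>The price/regime model of a primal solution\<close>

lemma sum_div2:
  "(\<Sum>s<2 * Suc J. h s) = (\<Sum>k\<le>J. h (2 * k) + h (2 * k + 1))" for h :: "nat \<Rightarrow> real"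
  by (induction J) (simp_all add: numeral_2_eq_2 add.assoc)

text \<open>A row of mass zero is replaced by the trivial martingale step that stays put.\<close>

definition normalized :: "nat \<Rightarrow> (nat \<Rightarrow> nat \<Rightarrow> nat \<Rightarrow> real) \<Rightarrow> nat \<Rightarrow> nat \<Rightarrow> nat \<Rightarrow> real" where
  "normalized J g n j k =
     (if (\<Sum>l\<le>J. g j l n) = 0 then of_bool (j = k) else g j k n / (\<Sum>l\<le>J. g j l n))"

lemma normalized_nonneg: "(\<And>l. l \<le> J \<Longrightarrow> g j l n \<ge> 0) \<Longrightarrow> k \<le> J \<Longrightarrow> normalized J g n j k \<ge> 0"
  by (auto simp: normalized_def intro!: divide_nonneg_nonneg sum_nonneg)

lemma sum_normalized: "j \<le> J \<Longrightarrow> (\<Sum>k\<le>J. normalized J g n j k) = 1"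
  by (cases "(\<Sum>l\<le>J. g j l n) = 0")
    (simp_all add: normalized_def of_bool_def sum_divide_distrib[symmetric])

lemma mean_normalized:
  assumes "j \<le> J" "(\<Sum>k\<le>J. (x k - x j) * g j k n) = 0"
  shows "(\<Sum>k\<le>J. normalized J g n j k * x k) = x j"
proof (cases "(\<Sum>l\<le>J. g j l n) = 0")
  case True
  have "(\<Sum>k\<le>J. normalized J g n j k * x k) = (\<Sum>k\<le>J. if k = j then x k else 0)"
    using True by (intro sum.cong) (auto simp: normalized_def)
  then show ?thesis using assms by simp
next
  case False
  have "(\<Sum>k\<le>J. g j k n * x k) = x j * (\<Sum>l\<le>J. g j l n)"
    using assms(2) by (simp add: algebra_simps sum_subtractf sum_distrib_left)
  then show ?thesis
    using False by (simp add: normalized_def sum_divide_distrib[symmetric])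
qed

text \<open>Also true for a row of mass zero: nonnegative entries with zero sum all vanish, whatever
  the replacement row is.\<close>

lemma mass_times_normalized:
  assumes "\<And>l. l \<le> J \<Longrightarrow> g j l n \<ge> 0" "k \<le> J"
  shows "(\<Sum>l\<le>J. g j l n) * normalized J g n j k = g j k n"
  using assms sum_nonneg_eq_0_iff[of "{..J}" "\<lambda>l. g j l n"] by (auto simp: normalized_def)

text \<open>States are encoded as natural numbers: \<^term>\<open>2 * j\<close> is price \<^term>\<open>x j\<close> in regime 1
  and \<^term>\<open>2 * j + 1\<close> the same price in regime 2. The state 0 at time 0 only carries the
  regime.\<close>

locale regime_data =
  fixes N J :: nat and x :: "nat \<Rightarrow> real" and s0 :: real and p :: "nat \<Rightarrow> nat \<Rightarrow> real"
    and f :: "nat \<Rightarrow> nat \<Rightarrow> real" and g1 g2 :: "nat \<Rightarrow> nat \<Rightarrow> nat \<Rightarrow> real"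
  assumes N: "N \<ge> 1" and inj: "inj_on x {..J}"
    and p_nonneg: "\<And>j n. j \<le> J \<Longrightarrow> n \<in> {1..N} \<Longrightarrow> p j n \<ge> 0"
    and p_sum: "(\<Sum>j\<le>J. p j 1) = 1" and p_mean: "(\<Sum>j\<le>J. p j 1 * x j) = s0"
    and primal: "primal_feasible N J x p f g1 g2"
begin

definition states :: "nat set" where
  "states = {..<2 * Suc J}"

lemma finite_states [simp]: "finite states"
  by (simp add: states_def)

lemma states_iff: "s \<in> states \<longleftrightarrow> s div 2 \<le> J"
  by (auto simp: states_def)

lemma sum_states: "(\<Sum>s\<in>states. h s) = (\<Sum>k\<le>J. h (2 * k) + h (2 * k + 1))" for h :: "nat \<Rightarrow> real"
  unfolding states_def by (rule sum_div2)

text \<open>The mass at price \<open>k\<close> that leaves time \<open>n\<close> in regime 2.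
  Nothing leaves time \<open>N\<close>; there the whole marginal is put into regime 2.\<close>

definition regime2 :: "nat \<Rightarrow> nat \<Rightarrow> real" where
  "regime2 k n = (if n = N then p k n else \<Sum>l\<le>J. g2 k l n)"

text \<open>The mass that reaches price \<open>k\<close> already in regime 2. Thus
  \<open>regime2 - inflow2\<close> has to switch at time \<open>n\<close>, out of the arriving
  regime 1 mass \<open>p - inflow2\<close>.\<close>

definition inflow2 :: "nat \<Rightarrow> nat \<Rightarrow> real" where
  "inflow2 k n = (if n = 1 then 0 else \<Sum>i\<le>J. g2 i k (n - 1))"

text \<open>Where no mass arrives in regime 1 the switching probability is set to 1, so that regime 2 is certain
  at time \<^term>\<open>N\<close>.\<close>

definition switch :: "nat \<Rightarrow> nat \<Rightarrow> real" where
  "switch n k = (if p k n = inflow2 k n then 1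
     else (regime2 k n - inflow2 k n) / (p k n - inflow2 k n))"

text \<open>The program has no variables for the first period; there the price is drawn directly
  from the first marginal.\<close>

definition price_kernel :: "nat \<Rightarrow> nat \<Rightarrow> nat \<Rightarrow> real" where
  "price_kernel n s k = (if n = 0 then p k 1
     else if even s then normalized J g1 n (s div 2) k else normalized J g2 n (s div 2) k)"

text \<open>The new price is drawn first and the regime afterwards, with a switching probability
  that sees only the new price; this order yields the regime condition of
  \<open>is_model2\<close>.\<close>

definition kernel :: "nat \<Rightarrow> nat \<Rightarrow> nat \<Rightarrow> real" where
  "kernel n s s' = price_kernel n s (s' div 2) *
     (if n = 0 \<or> even s
      then (if odd s' then switch (Suc n) (s' div 2) else 1 - switch (Suc n) (s' div 2))
      else of_bool (odd s'))"

text \<open>The one-time law of the chain predicted by the primal solution;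
  \<open>occupation_Suc\<close> verifies the prediction.\<close>

definition occupation :: "nat \<Rightarrow> nat \<Rightarrow> real" where
  "occupation n s = (if n = 0 then of_bool (s = 0)
     else if odd s then regime2 (s div 2) n else p (s div 2) n - regime2 (s div 2) n)"

lemma f_nonneg: "n \<in> {1..N} \<Longrightarrow> j \<le> J \<Longrightarrow> f j n \<ge> 0"
  and g_nonneg: "n \<in> {1..<N} \<Longrightarrow> j \<le> J \<Longrightarrow> k \<le> J \<Longrightarrow> g1 j k n \<ge> 0 \<and> g2 j k n \<ge> 0"
  and g_out: "n \<in> {1..<N} \<Longrightarrow> j \<le> J \<Longrightarrow> (\<Sum>k\<le>J. g1 j k n + g2 j k n) = p j n"
  and g_in: "n \<in> {2..N} \<Longrightarrow> j \<le> J \<Longrightarrow> (\<Sum>i\<le>J. g1 i j (n - 1) + g2 i j (n - 1)) = p j n"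
  and g1_mean: "n \<in> {1..<N} \<Longrightarrow> j \<le> J \<Longrightarrow> (\<Sum>k\<le>J. (x k - x j) * g1 j k n) = 0"
  and g2_mean: "n \<in> {1..<N} \<Longrightarrow> j \<le> J \<Longrightarrow> (\<Sum>k\<le>J. (x k - x j) * g2 j k n) = 0"
  using primal by (simp_all add: primal_feasible_def)

text \<open>Constraint (e) in probabilistic terms: no more is exercised at a node than switches
  there.\<close>

lemma exercise_le: "n \<in> {1..N} \<Longrightarrow> j \<le> J \<Longrightarrow> f j n \<le> regime2 j n - inflow2 j n"
proof (cases "n = N")
  case True
  assume "j \<le> J"
  then have "f j N + (if 1 < N then (\<Sum>i\<le>J. g2 i j (N - 1)) else 0) \<le> p j N"
    using primal by (simp add: primal_feasible_def)
  then show ?thesis using True N by (auto simp: regime2_def inflow2_def split: if_splits)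
next
  case False
  assume "n \<in> {1..N}" "j \<le> J"
  then have "n \<in> {1..<N}" using False by auto
  then have "f j n - (\<Sum>k\<le>J. g2 j k n) + (if 1 < n then (\<Sum>i\<le>J. g2 i j (n - 1)) else 0) \<le> 0"
    using primal \<open>j \<le> J\<close> unfolding primal_feasible_def by blast
  then show ?thesis using False \<open>n \<in> {1..N}\<close>
    by (auto simp: regime2_def inflow2_def split: if_splits)
qed

lemma regime2_le: "n \<in> {1..N} \<Longrightarrow> j \<le> J \<Longrightarrow> regime2 j n \<le> p j n"
  using g_out[of n j] g_nonneg[of n j] sum_nonneg[of "{..J}" "\<lambda>k. g1 j k n"]
  by (auto simp: regime2_def sum.distrib)

lemma inflow2_le: "n \<in> {1..N} \<Longrightarrow> j \<le> J \<Longrightarrow> inflow2 j n \<le> regime2 j n"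
  using exercise_le[of n j] f_nonneg[of n j] by simp

lemma switch_bounds:
  assumes "n \<in> {1..N}" "j \<le> J"
  shows "0 \<le> switch n j" "switch n j \<le> 1"
  using inflow2_le[OF assms] regime2_le[OF assms] by (auto simp: switch_def divide_simps)

text \<open>In the default case \<open>p = inflow2\<close>, the bounds
  \<open>inflow2 \<le> regime2 \<le> p\<close> collapse and both sides vanish.\<close>

lemma switch_mass:
  assumes "n \<in> {1..N}" "j \<le> J"
  shows "(p j n - inflow2 j n) * switch n j = regime2 j n - inflow2 j n"
  using inflow2_le[OF assms] regime2_le[OF assms] by (auto simp: switch_def)

lemma price_kernel_nonneg: "n < N \<Longrightarrow> s div 2 \<le> J \<Longrightarrow> k \<le> J \<Longrightarrow> price_kernel n s k \<ge> 0"
  using g_nonneg[of n "s div 2"] p_nonneg[of k 1] N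
  by (auto simp: price_kernel_def intro!: normalized_nonneg)

lemma sum_price_kernel: "s div 2 \<le> J \<Longrightarrow> (\<Sum>k\<le>J. price_kernel n s k) = 1"
  using p_sum by (cases "n = 0"; cases "even s") (auto simp: price_kernel_def sum_normalized)

lemma mean_price_kernel:
  assumes "n < N" "s div 2 \<le> J"
  shows "(\<Sum>k\<le>J. price_kernel n s k * x k) = (if n = 0 then s0 else x (s div 2))"
  using p_mean assms mean_normalized[of "s div 2" J x g1 n] mean_normalized[of "s div 2" J x g2 n]
    g1_mean[of n "s div 2"] g2_mean[of n "s div 2"]
  by (cases "n = 0"; cases "even s") (auto simp: price_kernel_def)

text \<open>Summing out the new regime leaves the price transition, so statements about prices alone
  never see \<open>switch\<close>.\<close>

lemma kernel_pair: "kernel n s (2 * k) + kernel n s (2 * k + 1) = price_kernel n s k"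
  by (simp add: kernel_def algebra_simps)

lemma sum_kernel_price:
  "(\<Sum>s'\<in>states. kernel n s s' * \<psi> (s' div 2)) = (\<Sum>k\<le>J. price_kernel n s k * \<psi> k)"
  unfolding sum_states kernel_pair[symmetric] by (simp add: algebra_simps)

sublocale finite_markov_chain states kernel 0 N
proof
  show "kernel n s s' \<ge> 0" if "n < N" "s \<in> states" "s' \<in> states" for n s s'
    using that price_kernel_nonneg[of n s "s' div 2"] switch_bounds[of "Suc n" "s' div 2"]
    by (auto simp: kernel_def states_iff)
  show "(\<Sum>s'\<in>states. kernel n s s') = 1" if "n < N" "s \<in> states" for n s
    using sum_kernel_price[of n s "\<lambda>_. 1"] sum_price_kernel[of s n] that by (simp add: states_iff)
qed (auto simp: states_iff)

text \<open>The initial price is separate because \<open>s0\<close> need not be a strike.\<close>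

definition price :: "nat \<Rightarrow> nat list \<Rightarrow> real" where
  "price n \<omega> = (if n = 0 then s0 else x (\<omega> ! n div 2))"

definition regime :: "nat \<Rightarrow> nat list \<Rightarrow> nat" where
  "regime n \<omega> = \<omega> ! n mod 2 + 1"

definition exercise_time :: "nat list \<Rightarrow> nat" where
  "exercise_time \<omega> = (LEAST n. odd (\<omega> ! n))"

text \<open>By (a) the regime 1 mass at \<open>j\<close> is the row sum of \<open>g1\<close>, which
  cancels the normalization; (b) then identifies the column sum of \<open>g1\<close>.\<close>

lemma occupation_even:
  assumes "n < N" "k \<le> J"
  shows "(\<Sum>s\<in>states. occupation n s * (of_bool (even s) * price_kernel n s k))
    = p k (Suc n) - inflow2 k (Suc n)"
proof (cases "n = 0")
  case True
  have "(\<Sum>s\<in>states. occupation n s * (of_bool (even s) * price_kernel n s k))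
      = (\<Sum>s\<in>states. if s = 0 then p k 1 else 0)"
    using True by (intro sum.cong) (auto simp: occupation_def price_kernel_def)
  then show ?thesis using True by (simp add: inflow2_def states_iff)
next
  case False
  then have n: "n \<in> {1..<N}" using assms by auto
  have "(p j n - regime2 j n) * normalized J g1 n j k = g1 j k n" if "j \<le> J" for j
  proof -
    have "p j n - regime2 j n = (\<Sum>l\<le>J. g1 j l n)"
      using g_out[OF n that] n by (simp add: regime2_def sum.distrib)
    then show ?thesis using mass_times_normalized[of J g1 j n k] g_nonneg[OF n that] assms by simp
  qed
  then have "(\<Sum>s\<in>states. occupation n s * (of_bool (even s) * price_kernel n s k)) = (\<Sum>j\<le>J. g1 j k n)"
    unfolding sum_states using False by (intro sum.cong) (auto simp: occupation_def price_kernel_def)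
  also have "\<dots> = p k (Suc n) - inflow2 k (Suc n)"
    using g_in[of "Suc n" k] n assms by (simp add: inflow2_def sum.distrib)
  finally show ?thesis .
qed

lemma occupation_odd:
  assumes "n < N" "k \<le> J"
  shows "(\<Sum>s\<in>states. occupation n s * (of_bool (odd s) * price_kernel n s k)) = inflow2 k (Suc n)"
proof (cases "n = 0")
  case True
  have "(\<Sum>s\<in>states. occupation n s * (of_bool (odd s) * price_kernel n s k)) = 0"
    using True by (intro sum.neutral) (auto simp: occupation_def)
  then show ?thesis using True by (simp add: inflow2_def)
next
  case False
  then have n: "n \<in> {1..<N}" using assms by auto
  have "regime2 j n * normalized J g2 n j k = g2 j k n" if "j \<le> J" for j
    using mass_times_normalized[of J g2 j n k] g_nonneg[OF n that] assms n by (simp add: regime2_def)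
  then have "(\<Sum>s\<in>states. occupation n s * (of_bool (odd s) * price_kernel n s k)) = (\<Sum>j\<le>J. g2 j k n)"
    unfolding sum_states using False by (intro sum.cong) (auto simp: occupation_def price_kernel_def)
  then show ?thesis using False by (simp add: inflow2_def)
qed

lemma kernel_to_regime2:
  assumes "s = 0 \<or> n \<noteq> 0"
  shows "kernel n s (2 * k + 1)
    = switch (Suc n) k * (of_bool (even s) * price_kernel n s k) + of_bool (odd s) * price_kernel n s k"
  using assms by (auto simp: kernel_def)

text \<open>Regime 2 receives the switching part of the arrivals from regime 1, which is
  \<open>regime2 - inflow2\<close>, and all arrivals from regime 2, which is \<open>inflow2\<close>.
  Regime 1 receives what remains of the total \<open>p\<close>.\<close>

lemma occupation_Suc:
  assumes n: "n < N" and s': "s' \<in> states"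
  shows "occupation (Suc n) s' = (\<Sum>s\<in>states. occupation n s * kernel n s s')"
proof -
  define k where "k = s' div 2"
  have k: "k \<le> J" "Suc n \<in> {1..N}" using n s' by (auto simp: k_def states_iff)
  have "(\<Sum>s\<in>states. occupation n s * kernel n s (2 * k + 1))
      = switch (Suc n) k * (\<Sum>s\<in>states. occupation n s * (of_bool (even s) * price_kernel n s k))
        + (\<Sum>s\<in>states. occupation n s * (of_bool (odd s) * price_kernel n s k))"
    unfolding sum_distrib_left sum.distrib[symmetric]
  proof (intro sum.cong refl)
    \<comment> \<open>At time 0 every state other than 0 has zero occupation, so
      \<open>kernel_to_regime2\<close> is needed only under its hypothesis.\<close>
    fix s
    show "occupation n s * kernel n s (2 * k + 1)
        = switch (Suc n) k * (occupation n s * (of_bool (even s) * price_kernel n s k))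
          + occupation n s * (of_bool (odd s) * price_kernel n s k)"
    proof (cases "s = 0 \<or> n \<noteq> 0")
      case True
      then show ?thesis unfolding kernel_to_regime2[OF True] by (simp add: algebra_simps)
    next
      case False
      then show ?thesis by (simp add: occupation_def)
    qed
  qed
  then have to2: "(\<Sum>s\<in>states. occupation n s * kernel n s (2 * k + 1)) = regime2 k (Suc n)"
    unfolding occupation_even[OF n k(1)] occupation_odd[OF n k(1)]
    using switch_mass[OF k(2,1)] by (simp add: mult.commute)
  have "(\<Sum>s\<in>states. occupation n s * price_kernel n s k)
      = (\<Sum>s\<in>states. occupation n s * (of_bool (even s) * price_kernel n s k))
        + (\<Sum>s\<in>states. occupation n s * (of_bool (odd s) * price_kernel n s k))"
    unfolding sum.distrib[symmetric] by (intro sum.cong) auto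
  then have "(\<Sum>s\<in>states. occupation n s * price_kernel n s k) = p k (Suc n)"
    unfolding occupation_even[OF n k(1)] occupation_odd[OF n k(1)] by simp
  then have to1: "(\<Sum>s\<in>states. occupation n s * kernel n s (2 * k)) = p k (Suc n) - regime2 k (Suc n)"
    unfolding kernel_pair[symmetric] distrib_left sum.distrib to2 by simp
  show ?thesis
  proof (cases "odd s'")
    case True
    then have "s' = 2 * k + 1" by (simp add: k_def)
    then show ?thesis using to2 by (simp add: occupation_def)
  next
    case False
    then have "s' = 2 * k" by (simp add: k_def)
    then show ?thesis using to1 by (simp add: occupation_def)
  qed
qed

lemma integral_occupation:
  fixes \<phi> :: "nat \<Rightarrow> real"
  assumes "n \<le> N"
  shows "(\<integral>\<omega>. \<phi> (\<omega> ! n) \<partial>chain) = (\<Sum>s\<in>states. occupation n s * \<phi> s)"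
  using assms occupation_Suc by (intro integral_marginal) (auto simp: occupation_def)

section \<open>Paths, regimes and the exercise time of the chain\<close>

lemma chain_price_index: "\<omega> \<in> chain_space \<Longrightarrow> n \<le> N \<Longrightarrow> \<omega> ! n div 2 \<le> J"
  using chain_space_nth[of \<omega> n] by (simp add: states_iff)

lemma price_eq_iff:
  "\<omega> \<in> chain_space \<Longrightarrow> n \<in> {1..N} \<Longrightarrow> j \<le> J \<Longrightarrow> price n \<omega> = x j \<longleftrightarrow> \<omega> ! n div 2 = j"
  using chain_price_index[of \<omega> n] inj by (auto simp: price_def inj_on_def)

lemma regime_step:
  assumes "\<omega> \<in> chain_space" "n < N" "odd (\<omega> ! n)"
  shows "odd (\<omega> ! Suc n)"
proof -
  have "n \<noteq> 0" using chain_space_init[OF assms(1)] assms(3) by (cases n) auto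
  then show ?thesis using chain_space_step[OF assms(1,2)] assms(3) by (auto simp: kernel_def)
qed

lemma regime_mono:
  assumes "\<omega> \<in> chain_space" "m \<le> n" "n \<le> N" "odd (\<omega> ! m)"
  shows "odd (\<omega> ! n)"
  using assms(2,3)
proof (induction n rule: dec_induct)
  case base
  show ?case by (rule assms)
next
  case (step n)
  then show ?case using regime_step[OF assms(1), of n] by simp
qed

text \<open>At \<open>N\<close> the masses \<open>regime2\<close> and \<open>p\<close> agree, so
  switching is certain and a path ending in regime 1 has weight zero.\<close>

lemma regime_final:
  assumes "\<omega> \<in> chain_space"
  shows "odd (\<omega> ! N)"
proof (rule ccontr)
  assume even: "\<not> odd (\<omega> ! N)"
  define n where "n = N - 1"
  have n: "n < N" "Suc n = N" using N by (auto simp: n_def)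
  have "switch N k = 1" for k by (simp add: switch_def regime2_def)
  then have "kernel n (\<omega> ! n) (\<omega> ! Suc n) = 0" using even n by (simp add: kernel_def)
  then show False using chain_space_step[OF assms n(1)] by simp
qed

text \<open>Regime 2 is never left, so the first visit is visible from two consecutive states. This
  makes the time a stopping time and its law a one-step computation.\<close>

lemma exercise_time_eq_iff:
  assumes "\<omega> \<in> chain_space" "n \<in> {1..N}"
  shows "exercise_time \<omega> = n \<longleftrightarrow> even (\<omega> ! (n - 1)) \<and> odd (\<omega> ! n)"
proof
  assume eq: "exercise_time \<omega> = n"
  have "odd (\<omega> ! n)"
    using LeastI[of "\<lambda>n. odd (\<omega> ! n)" N] regime_final[OF assms(1)] eq by (simp add: exercise_time_def)
  moreover have "even (\<omega> ! (n - 1))"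
    using not_less_Least[of "n - 1" "\<lambda>n. odd (\<omega> ! n)"] eq assms(2) by (auto simp: exercise_time_def)
  ultimately show "even (\<omega> ! (n - 1)) \<and> odd (\<omega> ! n)" by simp
next
  assume *: "even (\<omega> ! (n - 1)) \<and> odd (\<omega> ! n)"
  show "exercise_time \<omega> = n"
    unfolding exercise_time_def
  proof (rule Least_equality)
    show "odd (\<omega> ! n)" using * by simp
    fix m assume "odd (\<omega> ! m)"
    show "n \<le> m"
    proof (rule ccontr)
      assume "\<not> n \<le> m"
      then have "m \<le> n - 1" by simp
      with regime_mono[OF assms(1) this] * \<open>odd (\<omega> ! m)\<close> assms(2) show False by force
    qed
  qed
qed

lemma exercise_time_range:
  assumes "\<omega> \<in> chain_space"
  shows "exercise_time \<omega> \<in> {1..N}"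
proof -
  have "exercise_time \<omega> \<le> N"
    unfolding exercise_time_def by (rule Least_le) (rule regime_final[OF assms])
  moreover have "odd (\<omega> ! exercise_time \<omega>)"
    unfolding exercise_time_def by (rule LeastI) (rule regime_final[OF assms])
  then have "exercise_time \<omega> \<noteq> 0" using chain_space_init[OF assms] by (metis dvd_0_right)
  ultimately show ?thesis by simp
qed

lemma exercise_time_stopping: "is_stopping_time N chain history exercise_time"
  unfolding is_stopping_time_def
proof (intro conjI ballI)
  fix n assume n: "n \<in> {1..N}"
  have "{\<omega>\<in>chain_space. exercise_time \<omega> = n} \<in> sets (history n)"
  proof (rule history_Collect)
    fix \<omega> assume "\<omega> \<in> chain_space"
    then show "exercise_time \<omega> = n
        \<longleftrightarrow> even (take (Suc n) \<omega> ! (n - 1)) \<and> odd (take (Suc n) \<omega> ! n)"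
      using exercise_time_eq_iff n by simp
  qed
  then show "{\<omega>\<in>space chain. exercise_time \<omega> = n} \<in> sets (history n)" by simp
qed (use exercise_time_range in simp)

lemma integral_price_step:
  fixes \<psi> :: "nat \<Rightarrow> real"
  assumes "n < N" "A \<in> sets (history n)"
  shows "(\<integral>\<omega>. indicator A \<omega> * \<psi> (\<omega> ! Suc n div 2) \<partial>chain)
    = (\<integral>\<omega>. indicator A \<omega> * (\<Sum>k\<le>J. price_kernel n (\<omega> ! n) k * \<psi> k) \<partial>chain)"
  using integral_one_step[OF assms, of "\<lambda>s. \<psi> (s div 2)"] unfolding sum_kernel_price .

lemma integral_price_hits:
  assumes "n < N" "A \<in> sets (history n)" "k \<le> J"
  shows "(\<integral>\<omega>. indicator A \<omega> * of_bool (\<omega> ! Suc n div 2 = k) \<partial>chain)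
    = (\<integral>\<omega>. indicator A \<omega> * price_kernel n (\<omega> ! n) k \<partial>chain)"
proof -
  have "(\<Sum>l\<le>J. price_kernel n s l * of_bool (l = k)) = price_kernel n s k" for s
  proof -
    have "(\<Sum>l\<le>J. price_kernel n s l * of_bool (l = k)) = (\<Sum>l\<le>J. if l = k then price_kernel n s l else 0)"
      by (intro sum.cong) auto
    then show ?thesis using assms(3) by simp
  qed
  then show ?thesis
    using integral_price_step[OF assms(1,2), of "\<lambda>l. of_bool (l = k)"] by simp
qed

lemma price_marginal:
  assumes n: "n \<in> {1..N}" and j: "j \<le> J"
  shows "measure chain {\<omega>\<in>space chain. price n \<omega> = x j} = p j n"
proof -
  have "measure chain {\<omega>\<in>space chain. price n \<omega> = x j} = (\<integral>\<omega>. of_bool (price n \<omega> = x j) \<partial>chain)"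
    by (rule measure_chain_Collect)
  also have "\<dots> = (\<integral>\<omega>. of_bool (\<omega> ! n div 2 = j) \<partial>chain)"
    using price_eq_iff[OF _ n j] by (intro Bochner_Integration.integral_cong refl) simp
  also have "\<dots> = (\<Sum>s\<in>states. occupation n s * of_bool (s div 2 = j))"
    using n by (intro integral_occupation) simp
  also have "\<dots> = (\<Sum>k\<le>J. if k = j then p k n else 0)"
    unfolding sum_states using n by (intro sum.cong) (auto simp: occupation_def)
  finally show ?thesis using j by simp
qed

lemma chain_is_model: "is_model N J x s0 p chain history price"
  unfolding is_model_def
proof (intro conjI allI ballI impI)
  show "prob_space chain" by (rule prob_space_chain)
  show "space (history n) = space chain" for n by simp
  show "sets (history n) \<subseteq> sets chain" for n using sets.sets_into_space[of _ "history n"] by auto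
  show "sets (history m) \<subseteq> sets (history n)" if "m \<le> n \<and> n \<le> N" for m n
    using sets_history_mono that by simp
  show "price n \<in> borel_measurable (history n)" for n
    using state_measurable[of "\<lambda>s. if n = 0 then s0 else x (s div 2)" borel n]
    by (simp add: price_def[abs_def])
  show "price 0 \<omega> = s0" for \<omega> by (simp add: price_def)
  show "price n \<omega> \<in> x ` {0..J}" if "n \<in> {1..N}" "\<omega> \<in> space chain" for n \<omega>
    using that chain_price_index[of \<omega> n] by (auto simp: price_def)
  show "measure chain {\<omega>\<in>space chain. price n \<omega> = x j} = p j n" if "n \<in> {1..N}" "j \<le> J" for n j
    using that by (rule price_marginal)
  fix n A assume n: "n < N" and A: "A \<in> sets (history n)"
  have "(\<integral>\<omega>. indicator A \<omega> * price (Suc n) \<omega> \<partial>chain) = (\<integral>\<omega>. indicator A \<omega> * x (\<omega> ! Suc n div 2) \<partial>chain)"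
    by (simp add: price_def)
  also have "\<dots> = (\<integral>\<omega>. indicator A \<omega> * (\<Sum>k\<le>J. price_kernel n (\<omega> ! n) k * x k) \<partial>chain)"
    using n A by (rule integral_price_step)
  also have "\<dots> = (\<integral>\<omega>. indicator A \<omega> * price n \<omega> \<partial>chain)"
    using n chain_price_index
    by (intro Bochner_Integration.integral_cong refl) (simp add: price_def mean_price_kernel)
  finally show "(\<integral>\<omega>. indicator A \<omega> * price (Suc n) \<omega> \<partial>chain) = (\<integral>\<omega>. indicator A \<omega> * price n \<omega> \<partial>chain)" .
qed

text \<open>Within regime 1 the kernel factors into price transition and \<open>switch\<close>, and
  the second factor is constant once the new price is fixed.\<close>

lemma integral_switch:
  assumes n: "n < N" and A: "A \<in> sets (history n)" and k: "k \<le> J"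
    and even: "\<And>\<omega>. \<omega> \<in> A \<Longrightarrow> even (\<omega> ! n)"
  shows "(\<integral>\<omega>. indicator A \<omega> * of_bool (\<omega> ! Suc n = 2 * k + 1) \<partial>chain)
    = switch (Suc n) k * (\<integral>\<omega>. indicator A \<omega> * price_kernel n (\<omega> ! n) k \<partial>chain)"
proof -
  have "(\<Sum>s'\<in>states. kernel n s s' * of_bool (s' = 2 * k + 1)) = kernel n s (2 * k + 1)" for s
  proof -
    have "(\<Sum>s'\<in>states. kernel n s s' * of_bool (s' = 2 * k + 1))
        = (\<Sum>s'\<in>states. if s' = 2 * k + 1 then kernel n s s' else 0)"
      by (intro sum.cong) auto
    then show ?thesis using k by (simp add: states_iff)
  qed
  then have "(\<integral>\<omega>. indicator A \<omega> * of_bool (\<omega> ! Suc n = 2 * k + 1) \<partial>chain)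
      = (\<integral>\<omega>. indicator A \<omega> * kernel n (\<omega> ! n) (2 * k + 1) \<partial>chain)"
    using integral_one_step[OF n A, of "\<lambda>s. of_bool (s = 2 * k + 1)"] by simp
  also have "\<dots> = (\<integral>\<omega>. switch (Suc n) k * (indicator A \<omega> * price_kernel n (\<omega> ! n) k) \<partial>chain)"
    using even by (intro Bochner_Integration.integral_cong refl) (auto simp: kernel_def indicator_def)
  finally show ?thesis by simp
qed

lemma even_state_history: "A \<in> sets (history n) \<Longrightarrow> A \<inter> {\<omega>\<in>chain_space. even (\<omega> ! n)} \<in> sets (history n)"
  by (intro sets.Int history_Collect[where Q = "\<lambda>l. even (l ! n)"]) auto

lemma chain_is_model2: "is_model2 N J x s0 p chain history price"
  unfolding is_model2_def
proof (intro conjI chain_is_model exI[of _ regime] allI impI ballI)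
  \<comment> \<open>The model conditions ask for functions of the price; distinct strikes allow the
    index to be recovered from it.\<close>
  let ?i = "the_inv_into {..J} x"
  have i: "?i (x j) = j" if "j \<le> J" for j
    using the_inv_into_f_f[OF inj] that by simp
  show "regime n \<in> measurable (history n) (count_space UNIV)" for n
    using state_measurable[of "\<lambda>s. s mod 2 + 1" "count_space UNIV" n] by (simp add: regime_def[abs_def])
  show "regime n \<omega> \<in> {1, 2}" for n \<omega> by (auto simp: regime_def)
  show "regime 0 \<omega> = 1" if "\<omega> \<in> space chain" for \<omega>
    using chain_space_init[of \<omega>] that by (simp add: regime_def)
  show "regime n \<omega> \<le> regime (Suc n) \<omega>" if "n < N" "\<omega> \<in> space chain" for n \<omega>
    using regime_step[of \<omega> n] that by (cases "odd (\<omega> ! n)") (auto simp: regime_def odd_iff_mod_2_eq_one)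
  show "regime N \<omega> = 2" if "\<omega> \<in> space chain" for \<omega>
    using regime_final[of \<omega>] that by (simp add: regime_def odd_iff_mod_2_eq_one)
  fix n assume n: "n < N"
  show "\<exists>h :: real \<Rightarrow> nat \<Rightarrow> real. \<forall>A\<in>sets (history n).
      measure chain (A \<inter> {\<omega>\<in>space chain. price (Suc n) \<omega> = x k})
        = (\<integral>\<omega>. indicator A \<omega> * h (price n \<omega>) (regime n \<omega>) \<partial>chain)" if k: "k \<le> J" for k
  proof (intro exI ballI)
    fix A assume A: "A \<in> sets (history n)"
    have "measure chain (A \<inter> {\<omega>\<in>space chain. price (Suc n) \<omega> = x k})
        = (\<integral>\<omega>. indicator A \<omega> * of_bool (price (Suc n) \<omega> = x k) \<partial>chain)"
      by (rule measure_chain)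
    also have "\<dots> = (\<integral>\<omega>. indicator A \<omega> * of_bool (\<omega> ! Suc n div 2 = k) \<partial>chain)"
      using price_eq_iff[of _ "Suc n" k] n k by (intro Bochner_Integration.integral_cong refl) simp
    also have "\<dots> = (\<integral>\<omega>. indicator A \<omega> * price_kernel n (\<omega> ! n) k \<partial>chain)"
      using n A k by (rule integral_price_hits)
    \<comment> \<open>\<open>2 * ?i r + (d - 1)\<close> rebuilds the state from price and regime. At
      time 0, where \<open>s0\<close> may be off the lattice, \<open>price_kernel\<close> ignores
      the state.\<close>
    also have "\<dots> = (\<integral>\<omega>. indicator A \<omega> *
        (\<lambda>r d. price_kernel n (2 * ?i r + (d - 1)) k) (price n \<omega>) (regime n \<omega>) \<partial>chain)"
    proof (intro Bochner_Integration.integral_cong refl)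
      fix \<omega> assume \<omega>: "\<omega> \<in> space chain"
      have "price_kernel n (2 * ?i (price n \<omega>) + (regime n \<omega> - 1)) k = price_kernel n (\<omega> ! n) k"
        using i[OF chain_price_index[of \<omega> n]] \<omega> n
        by (cases "n = 0") (simp_all add: price_kernel_def price_def regime_def)
      then show "indicator A \<omega> * price_kernel n (\<omega> ! n) k = indicator A \<omega> *
          (\<lambda>r d. price_kernel n (2 * ?i r + (d - 1)) k) (price n \<omega>) (regime n \<omega>)" by simp
    qed
    finally show "measure chain (A \<inter> {\<omega>\<in>space chain. price (Suc n) \<omega> = x k})
        = (\<integral>\<omega>. indicator A \<omega> *
          (\<lambda>r d. price_kernel n (2 * ?i r + (d - 1)) k) (price n \<omega>) (regime n \<omega>) \<partial>chain)" .
  qed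
  show "\<exists>\<theta> :: real \<Rightarrow> real. \<forall>A\<in>sets (history n). \<forall>k\<le>J.
      measure chain (A \<inter> {\<omega>\<in>space chain. regime n \<omega> = 1 \<and> price (Suc n) \<omega> = x k \<and> regime (Suc n) \<omega> = 2})
        = \<theta> (x k) * measure chain (A \<inter> {\<omega>\<in>space chain. regime n \<omega> = 1 \<and> price (Suc n) \<omega> = x k})"
  proof (intro exI ballI allI impI)
    fix A k assume A: "A \<in> sets (history n)" and k: "k \<le> J"
    \<comment> \<open>Restricting to regime 1 keeps the event in the history, so both sides reduce
      to the same integral up to \<open>switch\<close>, which is therefore the witness for
      \<open>\<theta>\<close>.\<close>
    define B where "B = A \<inter> {\<omega>\<in>chain_space. even (\<omega> ! n)}"
    have B: "B \<in> sets (history n)" unfolding B_def using A by (rule even_state_history)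
    have hit: "price (Suc n) \<omega> = x k \<longleftrightarrow> \<omega> ! Suc n div 2 = k" if "\<omega> \<in> chain_space" for \<omega>
      using price_eq_iff[OF that, of "Suc n" k] n k by simp
    have odd_iff: "regime m \<omega> = 2 \<longleftrightarrow> odd (\<omega> ! m)" "regime m \<omega> = 1 \<longleftrightarrow> even (\<omega> ! m)" for m \<omega>
      by (auto simp: regime_def odd_iff_mod_2_eq_one even_iff_mod_2_eq_zero)
    have "A \<inter> {\<omega>\<in>space chain. regime n \<omega> = 1 \<and> price (Suc n) \<omega> = x k \<and> regime (Suc n) \<omega> = 2}
        = B \<inter> {\<omega>\<in>space chain. \<omega> ! Suc n = 2 * k + 1}"
      unfolding odd_iff B_def using hit by (auto elim!: oddE)
    then have "measure chain (A \<inter> {\<omega>\<in>space chain. regime n \<omega> = 1 \<and> price (Suc n) \<omega> = x k \<and> regime (Suc n) \<omega> = 2})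
        = (\<integral>\<omega>. indicator B \<omega> * of_bool (\<omega> ! Suc n = 2 * k + 1) \<partial>chain)"
      using measure_chain[of B] by simp
    also have "\<dots> = switch (Suc n) k * (\<integral>\<omega>. indicator B \<omega> * price_kernel n (\<omega> ! n) k \<partial>chain)"
      using n B k by (rule integral_switch) (simp add: B_def)
    also have "(\<integral>\<omega>. indicator B \<omega> * price_kernel n (\<omega> ! n) k \<partial>chain)
        = (\<integral>\<omega>. indicator B \<omega> * of_bool (\<omega> ! Suc n div 2 = k) \<partial>chain)"
      using integral_price_hits[OF n B k] by simp
    also have "\<dots> = measure chain (B \<inter> {\<omega>\<in>space chain. \<omega> ! Suc n div 2 = k})"
      using measure_chain[of B] by simp
    also have "B \<inter> {\<omega>\<in>space chain. \<omega> ! Suc n div 2 = k}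
        = A \<inter> {\<omega>\<in>space chain. regime n \<omega> = 1 \<and> price (Suc n) \<omega> = x k}"
      unfolding odd_iff B_def using hit by auto
    finally show "measure chain (A \<inter> {\<omega>\<in>space chain. regime n \<omega> = 1 \<and> price (Suc n) \<omega> = x k \<and> regime (Suc n) \<omega> = 2})
        = (\<lambda>r. switch (Suc n) (?i r)) (x k)
          * measure chain (A \<inter> {\<omega>\<in>space chain. regime n \<omega> = 1 \<and> price (Suc n) \<omega> = x k})"
      using i[OF k] by simp
  qed
qed

text \<open>The joint law of exercise time and price: arrivals in regime 1 times the switching
  probability.\<close>

lemma exercise_distribution:
  assumes n: "n < N" and j: "j \<le> J"
  shows "(\<integral>\<omega>. of_bool (even (\<omega> ! n) \<and> \<omega> ! Suc n = 2 * j + 1) \<partial>chain)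
    = regime2 j (Suc n) - inflow2 j (Suc n)"
proof -
  define B where "B = {\<omega>\<in>chain_space. even (\<omega> ! n)}"
  have B: "B \<in> sets (history n)"
    unfolding B_def by (rule history_Collect[where Q = "\<lambda>l. even (l ! n)"]) auto
  have "(\<integral>\<omega>. of_bool (even (\<omega> ! n) \<and> \<omega> ! Suc n = 2 * j + 1) \<partial>chain)
      = (\<integral>\<omega>. indicator B \<omega> * (of_bool (\<omega> ! Suc n = 2 * j + 1) :: real) \<partial>chain)"
    by (intro Bochner_Integration.integral_cong refl) (auto simp: B_def indicator_def)
  also have "\<dots> = switch (Suc n) j * (\<integral>\<omega>. indicator B \<omega> * price_kernel n (\<omega> ! n) j \<partial>chain)"
    using n B j by (rule integral_switch) (simp add: B_def)
  also have "(\<integral>\<omega>. indicator B \<omega> * price_kernel n (\<omega> ! n) j \<partial>chain)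
      = (\<integral>\<omega>. of_bool (even (\<omega> ! n)) * price_kernel n (\<omega> ! n) j \<partial>chain)"
    by (intro Bochner_Integration.integral_cong refl) (auto simp: B_def indicator_def)
  also have "\<dots> = p j (Suc n) - inflow2 j (Suc n)"
    using integral_occupation[of n "\<lambda>s. of_bool (even s) * price_kernel n s j"] occupation_even[OF n j] n
    by simp
  finally show ?thesis using switch_mass[of "Suc n" j] n j by (simp add: mult.commute)
qed

text \<open>The expected payoff is linear in the exercise law, which dominates \<open>f\<close> by
  \<open>exercise_le\<close>; nonnegativity of \<open>a\<close> preserves the order.\<close>

lemma exercise_payoff_ge:
  assumes a: "\<And>j n. j \<le> J \<Longrightarrow> n \<in> {1..N} \<Longrightarrow> a (x j) (t n) \<ge> 0"
  shows "(\<Sum>n=1..N. \<Sum>j\<le>J. a (x j) (t n) * f j n)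
    \<le> (\<integral>\<omega>. a (price (exercise_time \<omega>) \<omega>) (t (exercise_time \<omega>)) \<partial>chain)"
proof -
  have shift: "(\<Sum>n=1..N. h n) = (\<Sum>n<N. h (Suc n))" for h :: "nat \<Rightarrow> real"
    using sum.atLeast1_atMost_eq[of h N] by simp
  let ?I = "\<lambda>n j \<omega>. of_bool (even (\<omega> ! n) \<and> \<omega> ! Suc n = 2 * j + 1) :: real"
  have payoff: "a (price (exercise_time \<omega>) \<omega>) (t (exercise_time \<omega>))
      = (\<Sum>n<N. \<Sum>j\<le>J. a (x j) (t (Suc n)) * ?I n j \<omega>)" if \<omega>: "\<omega> \<in> space chain" for \<omega>
  proof -
    define m where "m = exercise_time \<omega>"
    have cs: "\<omega> \<in> chain_space" using \<omega> by simp
    have m: "m \<in> {1..N}" unfolding m_def using cs by (rule exercise_time_range)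
    define j where "j = \<omega> ! m div 2"
    have j: "j \<le> J" using chain_price_index[OF cs, of m] m by (simp add: j_def)
    have inner: "(\<Sum>k\<le>J. a (x k) (t (Suc n)) * ?I n k \<omega>) = (if n = m - 1 then a (x j) (t m) else 0)"
      if n: "n < N" for n
    proof (cases "n = m - 1")
      case True
      have "even (\<omega> ! n)" "odd (\<omega> ! m)" "Suc n = m"
        using exercise_time_eq_iff[OF cs m] True m by (auto simp: m_def)
      then have "?I n k \<omega> = of_bool (k = j)" for k by (auto simp: j_def elim!: oddE)
      then have "(\<Sum>k\<le>J. a (x k) (t (Suc n)) * ?I n k \<omega>) = (\<Sum>k\<le>J. if k = j then a (x k) (t m) else 0)"
        using \<open>Suc n = m\<close> by (intro sum.cong) auto
      then show ?thesis using j True by simp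
    next
      case False
      then have "exercise_time \<omega> \<noteq> Suc n" using m by (auto simp: m_def)
      then have "\<not> (even (\<omega> ! n) \<and> odd (\<omega> ! Suc n))"
        using exercise_time_eq_iff[OF cs, of "Suc n"] n by simp
      then have "(\<Sum>k\<le>J. a (x k) (t (Suc n)) * ?I n k \<omega>) = 0" by (intro sum.neutral) auto
      then show ?thesis using False by simp
    qed
    have "(\<Sum>n<N. \<Sum>k\<le>J. a (x k) (t (Suc n)) * ?I n k \<omega>) = (\<Sum>n<N. if n = m - 1 then a (x j) (t m) else 0)"
      using inner by (intro sum.cong refl) simp
    also have "\<dots> = a (x j) (t m)" using m by auto
    finally show ?thesis using m by (simp add: m_def j_def price_def)
  qed
  have int: "integrable chain h" for h :: "nat list \<Rightarrow> real"
    unfolding chain_def using finite_chain_space by (rule integrable_point_measure_finite)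
  have "(\<integral>\<omega>. a (price (exercise_time \<omega>) \<omega>) (t (exercise_time \<omega>)) \<partial>chain)
      = (\<integral>\<omega>. (\<Sum>n<N. \<Sum>j\<le>J. a (x j) (t (Suc n)) * ?I n j \<omega>) \<partial>chain)"
    by (intro Bochner_Integration.integral_cong refl payoff)
  also have "\<dots> = (\<Sum>n<N. \<integral>\<omega>. (\<Sum>j\<le>J. a (x j) (t (Suc n)) * ?I n j \<omega>) \<partial>chain)"
    by (intro Bochner_Integration.integral_sum int)
  also have "\<dots> = (\<Sum>n<N. \<Sum>j\<le>J. \<integral>\<omega>. a (x j) (t (Suc n)) * ?I n j \<omega> \<partial>chain)"
    by (intro sum.cong refl Bochner_Integration.integral_sum int)
  also have "\<dots> = (\<Sum>n<N. \<Sum>j\<le>J. a (x j) (t (Suc n)) * (regime2 j (Suc n) - inflow2 j (Suc n)))"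
    using exercise_distribution by (intro sum.cong refl) simp
  finally have eq: "(\<integral>\<omega>. a (price (exercise_time \<omega>) \<omega>) (t (exercise_time \<omega>)) \<partial>chain)
      = (\<Sum>n<N. \<Sum>j\<le>J. a (x j) (t (Suc n)) * (regime2 j (Suc n) - inflow2 j (Suc n)))" .
  show ?thesis
    unfolding eq shift using exercise_le a
    by (intro sum_mono mult_left_mono) auto
qed

end

subsection \<open>Call prices and the convex order\<close>

text \<open>The masses are differences of consecutive call slopes, so summation by parts moves one
  difference onto \<open>\<phi>\<close>.\<close>

lemma call_summation:
  fixes \<phi> x :: "nat \<Rightarrow> real"
  assumes "J \<ge> 1" "c 0 n = s0" "x 0 = 0"
  shows "(\<Sum>j\<le>J. pj J x s0 c j n * \<phi> j)
    = \<phi> 0 + (\<Sum>j<J. (c j n - c (Suc j) n) / (x (Suc j) - x j) * (\<phi> (Suc j) - \<phi> j))"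
proof -
  define q where "q j = (c j n - c (Suc j) n) / (x (Suc j) - x j)" for j
  obtain m where J: "J = Suc m" using assms by (cases J) auto
  have p0: "pj J x s0 c 0 n = 1 - q 0" using assms by (simp add: pj_def q_def)
  have pm: "pj J x s0 c (Suc j) n = q j - q (Suc j)" if "j < m" for j
    using that J by (simp add: pj_def q_def)
  have pJ: "pj J x s0 c (Suc m) n = q m" using J by (simp add: pj_def q_def)
  have "(\<Sum>j\<le>J. pj J x s0 c j n * \<phi> j)
      = pj J x s0 c 0 n * \<phi> 0 + (\<Sum>j<m. pj J x s0 c (Suc j) n * \<phi> (Suc j)) + pj J x s0 c (Suc m) n * \<phi> (Suc m)"
    unfolding J sum.atMost_Suc_shift[of _ m] by (simp add: lessThan_Suc_atMost[symmetric])
  also have "\<dots> = (1 - q 0) * \<phi> 0 + (\<Sum>j<m. (q j - q (Suc j)) * \<phi> (Suc j)) + q m * \<phi> (Suc m)"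
    by (simp add: p0 pm pJ)
  also have "\<dots> = \<phi> 0 + (\<Sum>j<Suc m. q j * (\<phi> (Suc j) - \<phi> j))"
    by (induction m) (simp_all add: algebra_simps)
  finally show ?thesis by (simp add: J q_def)
qed

text \<open>A second summation by parts, from call differences to call prices; the boundary term
  dies with the last call.\<close>

lemma call_summation2:
  fixes c m :: "nat \<Rightarrow> real"
  assumes "c (Suc J) = 0"
  shows "(\<Sum>j<Suc J. (c j - c (Suc j)) * m j) = c 0 * m 0 + (\<Sum>j<J. c (Suc j) * (m (Suc j) - m j))"
proof -
  have "(\<Sum>j<Suc J. (c j - c (Suc j)) * m j)
      = c 0 * m 0 + (\<Sum>j<J. c (Suc j) * (m (Suc j) - m j)) - c (Suc J) * m J"
    by (induction J) (simp_all add: algebra_simps)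
  then show ?thesis using assms by simp
qed

locale call_prices =
  fixes N J :: nat and x :: "nat \<Rightarrow> real" and s0 :: real and c :: "nat \<Rightarrow> nat \<Rightarrow> real"
  assumes N_pos: "N \<ge> 1" and J_pos: "J \<ge> 1"
    and x0: "x 0 = 0" and x_mono: "\<And>j. j < J \<Longrightarrow> x j < x (Suc j)"
    and c0: "\<And>n. n \<in> {1..N} \<Longrightarrow> c 0 n = s0"
    and C1: "\<And>n j. n \<in> {1..N} \<Longrightarrow> j < J \<Longrightarrow> c j n \<ge> c (Suc j) n"
    and C1': "\<And>n. n \<in> {1..N} \<Longrightarrow> c J n \<ge> 0"
    and C2a: "\<And>n. n \<in> {1..N} \<Longrightarrow> 1 \<ge> (c 0 n - c 1 n) / x 1"
    and C2b: "\<And>n j. n \<in> {1..N} \<Longrightarrow> 1 \<le> j \<Longrightarrow> j < J \<Longrightarrow>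
               (c (j - 1) n - c j n) / (x j - x (j - 1)) \<ge> (c j n - c (Suc j) n) / (x (Suc j) - x j)"
    and C3: "\<And>n j. 1 \<le> n \<Longrightarrow> n < N \<Longrightarrow> j \<le> J \<Longrightarrow> c j (Suc n) \<ge> c j n"
    and C4: "c J N = 0"
begin

abbreviation p :: "nat \<Rightarrow> nat \<Rightarrow> real" where
  "p \<equiv> pj J x s0 c"

text \<open>(C4) speaks about time \<open>N\<close> only; monotonicity (C3) carries it back to all
  earlier times.\<close>

lemma c_last:
  assumes "n \<in> {1..N}"
  shows "c J n = 0"
proof -
  have "c J n \<le> c J m" if "n \<le> m" "m \<le> N" for m
    using that
  proof (induction m rule: dec_induct)
    case (step m)
    then show ?case using C3[of m J] assms by simp
  qed simp
  from this[of N] have "c J n \<le> c J N" using assms by simp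
  then show ?thesis using C1'[OF assms] C4 by simp
qed

lemma strike_less: "i < j \<Longrightarrow> j \<le> J \<Longrightarrow> x i < x j"
proof (induction j)
  case (Suc j)
  then show ?case using x_mono[of j] by (cases "i = j") auto
qed simp

lemma strike_inj: "inj_on x {..J}"
  by (rule inj_onI) (metis atMost_iff less_irrefl linorder_neqE_nat strike_less)

lemma p_nonneg:
  assumes n: "n \<in> {1..N}" and "j \<le> J"
  shows "p j n \<ge> 0"
proof -
  consider "j = 0" | "1 \<le> j" "j < J" | "j = J" "j \<noteq> 0" using \<open>j \<le> J\<close> by linarith
  then show ?thesis
  proof cases
    case 1
    then show ?thesis using C2a[OF n] c0[OF n] by (simp add: pj_def)
  next
    case 2
    then show ?thesis using C2b[OF n, of j] by (simp add: pj_def)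
  next
    case 3
    then show ?thesis using C1[OF n, of "J - 1"] x_mono[of "J - 1"] by (simp add: pj_def)
  qed
qed

lemma p_sum: "n \<in> {1..N} \<Longrightarrow> (\<Sum>j\<le>J. p j n) = 1"
  using call_summation[of J c n s0 x "\<lambda>_. 1"] J_pos c0 x0 by simp

lemma p_mean:
  assumes n: "n \<in> {1..N}"
  shows "(\<Sum>j\<le>J. p j n * x j) = s0"
proof -
  have "(\<Sum>j\<le>J. p j n * x j)
      = x 0 + (\<Sum>j<J. (c j n - c (Suc j) n) / (x (Suc j) - x j) * (x (Suc j) - x j))"
    using J_pos c0[OF n] x0 by (rule call_summation)
  also have "\<dots> = (\<Sum>j<J. c j n - c (Suc j) n)"
    using x_mono x0 by (auto intro!: sum.cong dest!: x_mono)
  also have "\<dots> = c 0 n - c J n" by (rule sum_lessThan_telescope')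
  finally show ?thesis using c0[OF n] c_last[OF n] by simp
qed

text \<open>After two summations by parts, the expectation is a combination of call prices whose
  coefficients are changes of slope of \<open>\<phi>\<close>. These are nonpositive by concavity,
  and calls increase in time.\<close>

lemma concave_expectation_decreasing:
  assumes n: "1 \<le> n" "n < N"
    and concave: "\<And>j. 1 \<le> j \<Longrightarrow> j < J \<Longrightarrow>
      \<exists>d. \<phi> (Suc j) \<le> \<phi> j + d * (x (Suc j) - x j) \<and> \<phi> (j - 1) \<le> \<phi> j + d * (x (j - 1) - x j)"
  shows "(\<Sum>j\<le>J. p j (Suc n) * \<phi> j) \<le> (\<Sum>j\<le>J. p j n * \<phi> j)"
proof -
  define m where "m j = (\<phi> (Suc j) - \<phi> j) / (x (Suc j) - x j)" for j
  obtain J' where J': "J = Suc J'" using J_pos by (cases J) auto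
  have rep: "(\<Sum>j\<le>J. p j i * \<phi> j) = \<phi> 0 + (s0 * m 0 + (\<Sum>j<J'. c (Suc j) i * (m (Suc j) - m j)))"
    if i: "i \<in> {1..N}" for i
  proof -
    have "(\<Sum>j\<le>J. p j i * \<phi> j)
        = \<phi> 0 + (\<Sum>j<J. (c j i - c (Suc j) i) / (x (Suc j) - x j) * (\<phi> (Suc j) - \<phi> j))"
      using J_pos c0[OF i] x0 by (rule call_summation)
    also have "\<dots> = \<phi> 0 + (\<Sum>j<Suc J'. (c j i - c (Suc j) i) * m j)"
      by (simp add: m_def J')
    also have "(\<Sum>j<Suc J'. (c j i - c (Suc j) i) * m j)
        = s0 * m 0 + (\<Sum>j<J'. c (Suc j) i * (m (Suc j) - m j))"
      using call_summation2[of "\<lambda>j. c j i" J' m] c_last[OF i] J' c0[OF i] by simp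
    finally show ?thesis .
  qed
  have "(\<Sum>j<J'. c (Suc j) (Suc n) * (m (Suc j) - m j)) \<le> (\<Sum>j<J'. c (Suc j) n * (m (Suc j) - m j))"
  proof (rule sum_mono)
    fix j assume j: "j \<in> {..<J'}"
    obtain d where d: "\<phi> (Suc (Suc j)) \<le> \<phi> (Suc j) + d * (x (Suc (Suc j)) - x (Suc j))"
        "\<phi> j \<le> \<phi> (Suc j) + d * (x j - x (Suc j))"
      using concave[of "Suc j"] j J' by auto
    have pos: "x (Suc (Suc j)) - x (Suc j) > 0" "x (Suc j) - x j > 0"
      using x_mono[of "Suc j"] x_mono[of j] j J' by auto
    have "m (Suc j) \<le> d" using d(1) pos by (simp add: m_def pos_divide_le_eq)
    also have "d \<le> m j" using d(2) pos by (simp add: m_def pos_le_divide_eq algebra_simps)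
    finally show "c (Suc j) (Suc n) * (m (Suc j) - m j) \<le> c (Suc j) n * (m (Suc j) - m j)"
      using C3[of n "Suc j"] n j J' by (intro mult_right_mono_neg) auto
  qed
  then show ?thesis using rep[of n] rep[of "Suc n"] n by simp
qed

text \<open>One-period absence of arbitrage: it stands in, on the dual side, for the existence of a
  martingale coupling of two marginals (Strassen), and yields the lower bound 0 for the dual
  program.\<close>

lemma static_hedge_cost_nonneg:
  assumes n: "1 \<le> n" "n < N"
    and hedge: "\<And>j k. j \<le> J \<Longrightarrow> k \<le> J \<Longrightarrow> e1 j + e2 k + (x k - x j) * d j \<ge> 0"
  shows "(\<Sum>j\<le>J. p j n * e1 j) + (\<Sum>k\<le>J. p k (Suc n) * e2 k) \<ge> 0"
proof -
  text \<open>The minimum of affine functions \<^term>\<open>\<phi>\<close> separates \<^term>\<open>- e2\<close> from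
    \<^term>\<open>e1\<close>.\<close>
  define L where "L i k = e1 i + (x k - x i) * d i" for i k
  define \<phi> where "\<phi> k = Min ((\<lambda>i. L i k) ` {..J})" for k
  have \<phi>_le: "\<phi> k \<le> L i k" if "i \<le> J" for i k
    unfolding \<phi>_def using that by (intro Min_le) auto
  have \<phi>_att: "\<exists>i\<le>J. \<phi> k = L i k" for k
  proof -
    have "\<phi> k \<in> (\<lambda>i. L i k) ` {..J}" unfolding \<phi>_def by (intro Min_in) auto
    then show ?thesis by auto
  qed
  have "(\<Sum>j\<le>J. p j (Suc n) * \<phi> j) \<le> (\<Sum>j\<le>J. p j n * \<phi> j)"
  proof (rule concave_expectation_decreasing[OF n])
    fix j
    \<comment> \<open>The affine piece attaining the minimum at \<open>j\<close> lies above
      \<open>\<phi>\<close> and touches it there, so its slope serves both neighbours.\<close>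
    obtain i where i: "i \<le> J" "\<phi> j = L i j" using \<phi>_att by blast
    have "L i k = L i j + d i * (x k - x j)" for k by (simp add: L_def algebra_simps)
    then show "\<exists>d. \<phi> (Suc j) \<le> \<phi> j + d * (x (Suc j) - x j) \<and> \<phi> (j - 1) \<le> \<phi> j + d * (x (j - 1) - x j)"
      using \<phi>_le[OF i(1)] i(2) by metis
  qed
  moreover have "(\<Sum>j\<le>J. p j n * \<phi> j) \<le> (\<Sum>j\<le>J. p j n * e1 j)"
  proof (intro sum_mono mult_left_mono)
    fix j assume "j \<in> {..J}"
    then show "\<phi> j \<le> e1 j" using \<phi>_le[of j j] by (simp add: L_def)
  qed (use p_nonneg n in auto)
  moreover have "(\<Sum>k\<le>J. p k (Suc n) * - e2 k) \<le> (\<Sum>k\<le>J. p k (Suc n) * \<phi> k)"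
  proof (intro sum_mono mult_left_mono)
    fix k assume k: "k \<in> {..J}"
    obtain i where "i \<le> J" "\<phi> k = L i k" using \<phi>_att by blast
    then show "- e2 k \<le> \<phi> k" using hedge[of i k] k by (simp add: L_def)
  qed (use p_nonneg n in auto)
  ultimately show ?thesis by (simp add: sum_negf)
qed

end

subsection \<open>Optimal solutions of the two programs\<close>

text \<open>Comparison of coefficients, by testing with \<open>e = \<alpha> - \<beta>\<close> to get
  a vanishing sum of squares.\<close>

lemma double_sum_ext:
  fixes \<alpha> \<beta> :: "nat \<Rightarrow> nat \<Rightarrow> real"
  assumes fin: "finite A" "finite B"
    and eq: "\<And>e. (\<Sum>n\<in>A. \<Sum>j\<in>B. e j n * \<alpha> j n) = (\<Sum>n\<in>A. \<Sum>j\<in>B. e j n * \<beta> j n)"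
    and "n \<in> A" "j \<in> B"
  shows "\<alpha> j n = \<beta> j n"
proof -
  have "(\<Sum>n\<in>A. \<Sum>j\<in>B. (\<alpha> j n - \<beta> j n)\<^sup>2) = 0"
    using eq[of "\<lambda>j n. \<alpha> j n - \<beta> j n"]
    by (simp add: power2_eq_square right_diff_distrib sum_subtractf)
  then have "(\<Sum>j\<in>B. (\<alpha> j n - \<beta> j n)\<^sup>2) = 0"
    using fin \<open>n \<in> A\<close> by (subst (asm) sum_nonneg_eq_0_iff) (auto intro: sum_nonneg)
  then show ?thesis
    using fin \<open>j \<in> B\<close> by (subst (asm) sum_nonneg_eq_0_iff) auto
qed

type_synonym dual_vars =
  "(nat \<Rightarrow> nat \<Rightarrow> real) \<times> (nat \<Rightarrow> nat \<Rightarrow> real) \<times> (nat \<Rightarrow> nat \<Rightarrow> real)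
    \<times> (nat \<Rightarrow> nat \<Rightarrow> real) \<times> (nat \<Rightarrow> nat \<Rightarrow> real)"

text \<open>The summands index (i), (ii) and (iii); their multipliers become \<open>f\<close>,
  \<open>g1\<close> and \<open>g2\<close>.\<close>

type_synonym dual_index = "(nat \<times> nat) + (nat \<times> nat \<times> nat) + (nat \<times> nat \<times> nat)"

text \<open>The convention \<open>e1 j N = e2 j 1 = 0\<close> is built in by omitting these
  variables instead of constraining them.\<close>

fun dual_objective :: "nat \<Rightarrow> nat \<Rightarrow> (nat \<Rightarrow> nat \<Rightarrow> real) \<Rightarrow> dual_vars \<Rightarrow> real" where
  "dual_objective N J p (e1, e2, v, d1, d2) = (\<Sum>n\<in>{1..<N}. \<Sum>j\<le>J. e1 j n * p j n)
     + (\<Sum>n\<in>{1..<N}. \<Sum>j\<le>J. e2 j (Suc n) * p j (Suc n)) + (\<Sum>j\<le>J. v j N * p j N)"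

fun dual_constraint :: "(nat \<Rightarrow> real) \<Rightarrow> dual_index \<Rightarrow> dual_vars \<Rightarrow> real" where
  "dual_constraint x (Inl (n, j)) (e1, e2, v, d1, d2) = v j n"
| "dual_constraint x (Inr (Inl (n, j, k))) (e1, e2, v, d1, d2)
     = e1 j n + e2 k (Suc n) + (x k - x j) * d1 j n"
| "dual_constraint x (Inr (Inr (n, j, k))) (e1, e2, v, d1, d2)
     = e1 j n + e2 k (Suc n) + (x k - x j) * d2 j n - v j n + v k (Suc n)"

fun dual_bound :: "(nat \<Rightarrow> nat \<Rightarrow> real) \<Rightarrow> dual_index \<Rightarrow> real" where
  "dual_bound A (Inl (n, j)) = A j n"
| "dual_bound A (Inr i) = 0"

definition dual_indices :: "nat \<Rightarrow> nat \<Rightarrow> dual_index set" where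
  "dual_indices N J = ({1..N} \<times> {..J}) <+>
     (({1..<N} \<times> {..J} \<times> {..J}) <+> ({1..<N} \<times> {..J} \<times> {..J}))"

lemma finite_dual_indices: "finite (dual_indices N J)"
  by (simp add: dual_indices_def)

lemma linear_dual_constraint: "linear (dual_constraint x i)"
proof -
  consider n j where "i = Inl (n, j)" | n j k where "i = Inr (Inl (n, j, k))"
    | n j k where "i = Inr (Inr (n, j, k))"
    by (metis sum.exhaust prod_cases3 surj_pair)
  then show ?thesis
    by cases (auto intro!: linearI simp: algebra_simps)
qed

lemma linear_dual_objective: "linear (dual_objective N J p)"
  by (auto intro!: linearI simp: algebra_simps sum.distrib sum_distrib_left)

lemma dual_constraints_iff:
  "(\<forall>i\<in>dual_indices N J. dual_bound (\<lambda>j n. a (x j) (t n)) i \<le> dual_constraint x i (e1, e2, v, d1, d2)) \<longleftrightarrow>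
      (\<forall>n\<in>{1..N}. \<forall>j\<le>J. v j n \<ge> a (x j) (t n))
      \<and> (\<forall>n\<in>{1..<N}. \<forall>j\<le>J. \<forall>k\<le>J. e1 j n + e2 k (Suc n) + (x k - x j) * d1 j n \<ge> 0
        \<and> e1 j n + e2 k (Suc n) + (x k - x j) * d2 j n - v j n + v k (Suc n) \<ge> 0)"
  unfolding dual_indices_def by (simp add: Plus_def ball_Un) blast

lemma sum_dual_indices:
  "(\<Sum>i\<in>dual_indices N J. w i * h i)
    = (\<Sum>n=1..N. \<Sum>j\<le>J. w (Inl (n, j)) * h (Inl (n, j)))
    + ((\<Sum>n\<in>{1..<N}. \<Sum>j\<le>J. \<Sum>k\<le>J. w (Inr (Inl (n, j, k))) * h (Inr (Inl (n, j, k))))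
    + (\<Sum>n\<in>{1..<N}. \<Sum>j\<le>J. \<Sum>k\<le>J. w (Inr (Inr (n, j, k))) * h (Inr (Inr (n, j, k)))))"
  for h :: "dual_index \<Rightarrow> real"
  unfolding dual_indices_def by (simp add: sum.Plus sum.cartesian_product' comp_def)

section \<open>Reading a primal solution off the multipliers\<close>

context call_prices
begin

lemma sum_split_last: "(\<Sum>n=1..N. h n) = (\<Sum>n\<in>{1..<N}. h n) + h N" for h :: "nat \<Rightarrow> real"
proof -
  have "{1..N} = insert N {1..<N}" using N_pos by auto
  then show ?thesis by simp
qed

lemma sum_split_first: "(\<Sum>n=1..N. h n) = h 1 + (\<Sum>n\<in>{1..<N}. h (Suc n))" for h :: "nat \<Rightarrow> real"
  using sum.atLeast_Suc_atMost[OF N_pos, of h] sum.shift_bounds_Suc_ivl[of h 1 N]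
  by (simp add: atLeastLessThanSuc_atLeastAtMost)

lemma lp_solution:
  assumes a_nonneg: "\<And>j n. j \<le> J \<Longrightarrow> n \<in> {1..N} \<Longrightarrow> a (x j) (t n) \<ge> 0"
  obtains e1 e2 v d1 d2 f g1 g2 where
    "dual_feasible N t J x a e1 e2 v d1 d2" "primal_feasible N J x p f g1 g2"
    "(\<Sum>n=1..N. \<Sum>j\<le>J. (e1 j n + e2 j n) * p j n) + (\<Sum>j\<le>J. v j N * p j N)
      \<le> (\<Sum>n=1..N. \<Sum>j\<le>J. a (x j) (t n) * f j n)"
proof -
  let ?I = "dual_indices N J" and ?u = "dual_objective N J p"
  let ?b = "dual_bound (\<lambda>j n. a (x j) (t n))" and ?l = "dual_constraint x"
  \<comment> \<open>Feasible point: a constant \<open>v\<close> above every payoff, with all other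
    variables zero, turns (ii) and (iii) into \<open>0 \<ge> 0\<close>.\<close>
  define C where "C = (\<Sum>n=1..N. \<Sum>j\<le>J. a (x j) (t n))"
  have C: "a (x j) (t n) \<le> C" if "n \<in> {1..N}" "j \<le> J" for j n
  proof -
    have "a (x j) (t n) \<le> (\<Sum>j\<le>J. a (x j) (t n))"
      using that a_nonneg by (intro member_le_sum) auto
    also have "\<dots> \<le> C"
      unfolding C_def using that a_nonneg
      by (intro member_le_sum[of n "{1..N}" "\<lambda>n. \<Sum>j\<le>J. a (x j) (t n)"]) (auto intro!: sum_nonneg)
    finally show ?thesis .
  qed
  have feas: "?b i \<le> ?l i (0, 0, \<lambda>_ _. C, 0, 0)" if "i \<in> ?I" for i
  proof -
    have "\<forall>i\<in>?I. ?b i \<le> ?l i (0, 0, \<lambda>_ _. C, 0, 0)"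
      unfolding dual_constraints_iff using C by simp
    then show ?thesis using that by blast
  qed
  have bounded: "0 \<le> ?u y" if y: "\<And>i. i \<in> ?I \<Longrightarrow> ?b i \<le> ?l i y" for y
  proof -
    obtain e1 e2 v d1 d2 where y_eq: "y = (e1, e2, v, d1, d2)" by (cases y)
    have "\<forall>i\<in>?I. ?b i \<le> ?l i (e1, e2, v, d1, d2)" using y y_eq by blast
    then have c: "\<And>n j. n \<in> {1..N} \<Longrightarrow> j \<le> J \<Longrightarrow> v j n \<ge> a (x j) (t n)"
        "\<And>n j k. n \<in> {1..<N} \<Longrightarrow> j \<le> J \<Longrightarrow> k \<le> J \<Longrightarrow> e1 j n + e2 k (Suc n) + (x k - x j) * d1 j n \<ge> 0"
      unfolding dual_constraints_iff by blast+
    have "0 \<le> (\<Sum>n\<in>{1..<N}. (\<Sum>j\<le>J. p j n * e1 j n) + (\<Sum>j\<le>J. p j (Suc n) * e2 j (Suc n)))"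
    proof (rule sum_nonneg)
      fix n assume n: "n \<in> {1..<N}"
      show "0 \<le> (\<Sum>j\<le>J. p j n * e1 j n) + (\<Sum>j\<le>J. p j (Suc n) * e2 j (Suc n))"
        by (rule static_hedge_cost_nonneg[where d = "\<lambda>j. d1 j n"]) (use n c(2) in auto)
    qed
    moreover have "0 \<le> (\<Sum>j\<le>J. v j N * p j N)"
    proof (intro sum_nonneg mult_nonneg_nonneg)
      fix j assume "j \<in> {..J}"
      then show "0 \<le> v j N" "0 \<le> p j N"
        using c(1)[of N j] a_nonneg[of j N] p_nonneg[of N j] N_pos by auto
    qed
    ultimately show ?thesis by (simp add: y_eq sum.distrib mult.commute)
  qed
  obtain y w where yw: "\<And>i. i \<in> ?I \<Longrightarrow> ?b i \<le> ?l i y" "\<And>i. i \<in> ?I \<Longrightarrow> w i \<ge> 0"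
      "\<And>y'. ?u y' = (\<Sum>i\<in>?I. w i * ?l i y')" "?u y \<le> (\<Sum>i\<in>?I. w i * ?b i)"
    using lp_strong_duality[of ?I ?l ?u ?b "(0, 0, \<lambda>_ _. C, 0, 0)" 0]
      finite_dual_indices linear_dual_constraint linear_dual_objective feas bounded by blast
  obtain e1 e2 v d1 d2 where y_eq: "y = (e1, e2, v, d1, d2)" by (cases y)
  have "\<forall>i\<in>?I. ?b i \<le> ?l i (e1, e2, v, d1, d2)" using yw(1) y_eq by blast
  note c = this[unfolded dual_constraints_iff]
  \<comment> \<open>The zeroed entries occur neither in the objective nor in (ii), (iii), so both
    are preserved.\<close>
  define e1' where "e1' j n = (if n = N then 0 else e1 j n)" for j n
  define e2' where "e2' j n = (if n = 1 then 0 else e2 j n)" for j n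
  have dual: "dual_feasible N t J x a e1' e2' v d1 d2"
    unfolding dual_feasible_def
  proof (intro conjI)
    show "\<forall>j\<le>J. e1' j N = 0 \<and> e2' j 1 = 0" by (simp add: e1'_def e2'_def)
    show "\<forall>n\<in>{1..N}. \<forall>j\<le>J. 0 \<le> v j n \<and> a (x j) (t n) \<le> v j n"
      using c a_nonneg by (meson order_trans)
    show "\<forall>n\<in>{1..<N}. \<forall>j\<le>J. \<forall>k\<le>J. 0 \<le> e1' j n + e2' k (Suc n) + (x k - x j) * d1 j n
        \<and> 0 \<le> e1' j n + e2' k (Suc n) + (x k - x j) * d2 j n - v j n + v k (Suc n)"
      using c by (simp add: e1'_def e2'_def)
  qed
  have obj: "(\<Sum>n=1..N. \<Sum>j\<le>J. (e1' j n + e2' j n) * p j n) + (\<Sum>j\<le>J. v j N * p j N) = ?u y"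
  proof -
    have "(\<Sum>n=1..N. \<Sum>j\<le>J. (e1' j n + e2' j n) * p j n)
        = (\<Sum>n=1..N. \<Sum>j\<le>J. e1' j n * p j n) + (\<Sum>n=1..N. \<Sum>j\<le>J. e2' j n * p j n)"
      by (simp add: distrib_right sum.distrib)
    also have "(\<Sum>n=1..N. \<Sum>j\<le>J. e1' j n * p j n) = (\<Sum>n\<in>{1..<N}. \<Sum>j\<le>J. e1 j n * p j n)"
      unfolding sum_split_last by (auto simp: e1'_def intro!: sum.cong)
    also have "(\<Sum>n=1..N. \<Sum>j\<le>J. e2' j n * p j n) = (\<Sum>n\<in>{1..<N}. \<Sum>j\<le>J. e2 j (Suc n) * p j (Suc n))"
      unfolding sum_split_first by (auto simp: e2'_def intro!: sum.cong)
    finally show ?thesis by (simp add: y_eq)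
  qed

  define f where "f j n = w (Inl (n, j))" for j n
  define g1 where "g1 j k n = w (Inr (Inl (n, j, k)))" for j k n
  define g2 where "g2 j k n = w (Inr (Inr (n, j, k)))" for j k n
  have nonneg: "\<And>n j. n \<in> {1..N} \<Longrightarrow> j \<le> J \<Longrightarrow> f j n \<ge> 0"
      "\<And>n j k. n \<in> {1..<N} \<Longrightarrow> j \<le> J \<Longrightarrow> k \<le> J \<Longrightarrow> g1 j k n \<ge> 0 \<and> g2 j k n \<ge> 0"
    unfolding f_def g1_def g2_def by (auto simp: dual_indices_def intro!: yw(2))
  have optimum: "(\<Sum>i\<in>?I. w i * ?b i) = (\<Sum>n=1..N. \<Sum>j\<le>J. a (x j) (t n) * f j n)"
    unfolding sum_dual_indices by (simp add: f_def mult.commute)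
  \<comment> \<open>This holds for all arrays. Setting all blocks but one to zero isolates a primal
    constraint: \<open>e1\<close> gives (a), \<open>e2\<close> gives (b), \<open>d1\<close> and
    \<open>d2\<close> give (c) and (d), \<open>v\<close> gives (e).\<close>
  have ident: "?u (e1, e2, v, d1, d2) = (\<Sum>n=1..N. \<Sum>j\<le>J. f j n * v j n)
      + ((\<Sum>n\<in>{1..<N}. \<Sum>j\<le>J. \<Sum>k\<le>J. g1 j k n * (e1 j n + e2 k (Suc n) + (x k - x j) * d1 j n))
      + (\<Sum>n\<in>{1..<N}. \<Sum>j\<le>J. \<Sum>k\<le>J. g2 j k n *
          (e1 j n + e2 k (Suc n) + (x k - x j) * d2 j n - v j n + v k (Suc n))))"
    for e1 e2 v d1 d2
    unfolding yw(3) sum_dual_indices dual_constraint.simps f_def g1_def g2_def ..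
  have swap: "(\<Sum>n\<in>A. \<Sum>j\<le>J. \<Sum>k\<le>J. h n j k) = (\<Sum>n\<in>A. \<Sum>k\<le>J. \<Sum>j\<le>J. h n j k)"
    for A :: "nat set" and h :: "nat \<Rightarrow> nat \<Rightarrow> nat \<Rightarrow> real"
    by (intro sum.cong refl sum.swap)

  have out: "p j n = (\<Sum>k\<le>J. g1 j k n + g2 j k n)" if "n \<in> {1..<N}" "j \<le> J" for n j
  proof (rule double_sum_ext[where A = "{1..<N}" and B = "{..J}"
        and \<alpha> = p and \<beta> = "\<lambda>j n. \<Sum>k\<le>J. g1 j k n + g2 j k n"])
    fix e
    show "(\<Sum>n\<in>{1..<N}. \<Sum>j\<le>J. e j n * p j n)
        = (\<Sum>n\<in>{1..<N}. \<Sum>j\<le>J. e j n * (\<Sum>k\<le>J. g1 j k n + g2 j k n))"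
      using ident[of e 0 0 0 0] by (simp add: sum_distrib_left sum.distrib distrib_left mult.commute)
  qed (use that in auto)
  \<comment> \<open>\<open>e2\<close> enters at \<open>Suc n\<close>, so the test array is shifted
    to \<open>e k (n - 1)\<close>.\<close>
  have inn: "p k (Suc n) = (\<Sum>j\<le>J. g1 j k n + g2 j k n)" if "n \<in> {1..<N}" "k \<le> J" for n k
  proof (rule double_sum_ext[where A = "{1..<N}" and B = "{..J}" 
        and \<alpha> = "\<lambda>k n. p k (Suc n)" and \<beta> = "\<lambda>k n. \<Sum>j\<le>J. g1 j k n + g2 j k n"])
    fix e
    show "(\<Sum>n\<in>{1..<N}. \<Sum>k\<le>J. e k n * p k (Suc n))
        = (\<Sum>n\<in>{1..<N}. \<Sum>k\<le>J. e k n * (\<Sum>j\<le>J. g1 j k n + g2 j k n))"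
      using ident[of 0 "\<lambda>k n. e k (n - 1)" 0 0 0]
        swap[of "\<lambda>n j k. g1 j k n * e k n" "{1..<N}"] swap[of "\<lambda>n j k. g2 j k n * e k n" "{1..<N}"]
      by (simp add: sum_distrib_left sum.distrib distrib_left mult.commute)
  qed (use that in auto)
  have mean1: "(\<Sum>k\<le>J. (x k - x j) * g1 j k n) = 0" if "n \<in> {1..<N}" "j \<le> J" for n j
  proof (rule double_sum_ext[where A = "{1..<N}" and B = "{..J}"
        and \<alpha> = "\<lambda>j n. \<Sum>k\<le>J. (x k - x j) * g1 j k n" and \<beta> = "\<lambda>_ _. 0"])
    fix e
    show "(\<Sum>n\<in>{1..<N}. \<Sum>j\<le>J. e j n * (\<Sum>k\<le>J. (x k - x j) * g1 j k n))
        = (\<Sum>n\<in>{1..<N}. \<Sum>j\<le>J. e j n * 0)"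
      using ident[of 0 0 0 e 0] by (simp add: sum_distrib_left mult_ac)
  qed (use that in auto)
  have mean2: "(\<Sum>k\<le>J. (x k - x j) * g2 j k n) = 0" if "n \<in> {1..<N}" "j \<le> J" for n j
  proof (rule double_sum_ext[where A = "{1..<N}" and B = "{..J}"
        and \<alpha> = "\<lambda>j n. \<Sum>k\<le>J. (x k - x j) * g2 j k n" and \<beta> = "\<lambda>_ _. 0"])
    fix e
    show "(\<Sum>n\<in>{1..<N}. \<Sum>j\<le>J. e j n * (\<Sum>k\<le>J. (x k - x j) * g2 j k n))
        = (\<Sum>n\<in>{1..<N}. \<Sum>j\<le>J. e j n * 0)"
      using ident[of 0 0 0 0 e] by (simp add: sum_distrib_left mult_ac)
  qed (use that in auto)
  \<comment> \<open>As \<open>v\<close> is free, (e) comes out with equality. The cases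
    \<open>n = N\<close> and \<open>n = 1\<close> record that regime 2 has no outflow at the end and
    no inflow at the start.\<close>
  have flow: "f j n - (if n = N then 0 else \<Sum>k\<le>J. g2 j k n) + (if n = 1 then 0 else \<Sum>i\<le>J. g2 i j (n - 1))
      = (if n = N then p j N else 0)" if "n \<in> {1..N}" "j \<le> J" for n j
  proof (rule double_sum_ext[where A = "{1..N}" and B = "{..J}"
        and \<alpha> = "\<lambda>j n. f j n - (if n = N then 0 else \<Sum>k\<le>J. g2 j k n) + (if n = 1 then 0 else \<Sum>i\<le>J. g2 i j (n - 1))"
        and \<beta> = "\<lambda>j n. if n = N then p j N else 0"])
    fix e :: "nat \<Rightarrow> nat \<Rightarrow> real"
    have s1: "(\<Sum>n=1..N. \<Sum>j\<le>J. e j n * (if n = N then 0 else \<Sum>k\<le>J. g2 j k n))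
        = (\<Sum>n\<in>{1..<N}. \<Sum>j\<le>J. \<Sum>k\<le>J. g2 j k n * e j n)"
      unfolding sum_split_last by (auto simp: sum_distrib_left mult.commute intro!: sum.cong)
    have s2: "(\<Sum>n=1..N. \<Sum>j\<le>J. e j n * (if n = 1 then 0 else \<Sum>i\<le>J. g2 i j (n - 1)))
        = (\<Sum>n\<in>{1..<N}. \<Sum>j\<le>J. \<Sum>k\<le>J. g2 j k n * e k (Suc n))"
      unfolding sum_split_first swap[of "\<lambda>n j k. g2 j k n * e k (Suc n)"]
      by (auto simp: sum_distrib_left mult.commute intro!: sum.cong)
    have s3: "(\<Sum>n=1..N. \<Sum>j\<le>J. e j n * (if n = N then p j N else 0)) = (\<Sum>j\<le>J. e j N * p j N)"
      unfolding sum_split_last by simp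
    have "(\<Sum>n=1..N. \<Sum>j\<le>J. e j n *
          (f j n - (if n = N then 0 else \<Sum>k\<le>J. g2 j k n) + (if n = 1 then 0 else \<Sum>i\<le>J. g2 i j (n - 1))))
        = (\<Sum>n=1..N. \<Sum>j\<le>J. e j n * f j n)
          - (\<Sum>n=1..N. \<Sum>j\<le>J. e j n * (if n = N then 0 else \<Sum>k\<le>J. g2 j k n))
          + (\<Sum>n=1..N. \<Sum>j\<le>J. e j n * (if n = 1 then 0 else \<Sum>i\<le>J. g2 i j (n - 1)))"
      by (simp only: distrib_left right_diff_distrib sum.distrib sum_subtractf)
    also have "\<dots> = (\<Sum>j\<le>J. e j N * p j N)"
      unfolding s1 s2 using ident[of 0 0 e 0 0]
      by (simp add: distrib_left right_diff_distrib sum.distrib sum_subtractf sum_negf mult.commute)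
    finally show "(\<Sum>n=1..N. \<Sum>j\<le>J. e j n *
          (f j n - (if n = N then 0 else \<Sum>k\<le>J. g2 j k n) + (if n = 1 then 0 else \<Sum>i\<le>J. g2 i j (n - 1))))
        = (\<Sum>n=1..N. \<Sum>j\<le>J. e j n * (if n = N then p j N else 0))"
      unfolding s3 .
  qed (use that in auto)
  have primal: "primal_feasible N J x p f g1 g2"
    unfolding primal_feasible_def
  proof (intro conjI)
    show "\<forall>n\<in>{2..N}. \<forall>j\<le>J. (\<Sum>i\<le>J. g1 i j (n - 1) + g2 i j (n - 1)) = p j n"
    proof (intro ballI allI impI)
      fix n j assume "n \<in> {2..N}" "j \<le> J"
      then show "(\<Sum>i\<le>J. g1 i j (n - 1) + g2 i j (n - 1)) = p j n"
        using inn[of "n - 1" j] by (cases n) auto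
    qed
    show "\<forall>n\<in>{1..<N}. \<forall>j\<le>J.
        f j n - (\<Sum>k\<le>J. g2 j k n) + (if 1 < n then (\<Sum>i\<le>J. g2 i j (n - 1)) else 0) \<le> 0"
    proof (intro ballI allI impI)
      fix n j assume "n \<in> {1..<N}" "j \<le> J"
      then show "f j n - (\<Sum>k\<le>J. g2 j k n) + (if 1 < n then (\<Sum>i\<le>J. g2 i j (n - 1)) else 0) \<le> 0"
        using flow[of n j] by (auto split: if_splits)
    qed
    show "\<forall>j\<le>J. f j N + (if 1 < N then (\<Sum>i\<le>J. g2 i j (N - 1)) else 0) \<le> p j N"
    proof (intro allI impI)
      fix j assume "j \<le> J"
      then show "f j N + (if 1 < N then (\<Sum>i\<le>J. g2 i j (N - 1)) else 0) \<le> p j N"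
        using flow[of N j] N_pos by (auto split: if_splits)
    qed
  qed (use nonneg out mean1 mean2 in auto)
  show ?thesis
    using that[OF dual primal] yw(4) unfolding obj optimum by blast
qed

lemma regime_data: "primal_feasible N J x p f g1 g2 \<Longrightarrow> regime_data N J x s0 p f g1 g2"
  using N_pos strike_inj p_nonneg p_sum[of 1] p_mean[of 1] by unfold_locales auto

lemma ex_model2_ge:
  assumes a_nonneg: "\<And>j n. j \<le> J \<Longrightarrow> n \<in> {1..N} \<Longrightarrow> a (x j) (t n) \<ge> 0"
    and primal: "primal_feasible N J x p f g1 g2"
    and sup: "super_replicates N t J x a b \<Theta>1 \<Theta>2"
  shows "\<exists>(M :: nat list measure) F X. is_model2 N J x s0 p M F X
    \<and> (\<Sum>n=1..N. \<Sum>j\<le>J. a (x j) (t n) * f j n) \<le> phi N t a M F X"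
proof -
  interpret regime_data N J x s0 p f g1 g2 using primal by (rule regime_data)
  have "(\<integral>\<omega>. a (price (exercise_time \<omega>) \<omega>) (t (exercise_time \<omega>)) \<partial>chain) \<le> phi N t a chain history price"
    unfolding phi_def using exercise_time_stopping payoff_set_bdd_above[OF chain_is_model sup]
    by (intro cSup_upper) auto
  with exercise_payoff_ge[where a = a and t = t, OF a_nonneg] chain_is_model2 show ?thesis
    by (meson order_trans)
qed

end

text \<open>\<open>model_sup\<close> ranges over one sample type, and \<open>nat list\<close>
  carries the constructed chain. The fourth conjunct gives the bound for models on any other type,
  so this choice does not restrict the supremum.\<close>

theorem mainTheorem1:
  fixes N J :: nat and t x :: "nat \<Rightarrow> real" and s0 :: real
    and c :: "nat \<Rightarrow> nat \<Rightarrow> real" and a :: "real \<Rightarrow> real \<Rightarrow> real"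
  assumes N_pos: "N \<ge> 1" and J_pos: "J \<ge> 1"
    and t0: "t 0 = 0" and t_mono: "\<And>n. n < N \<Longrightarrow> t n < t (Suc n)"
    and s0_pos: "s0 > 0"
    and x0: "x 0 = 0" and x_mono: "\<And>j. j < J \<Longrightarrow> x j < x (Suc j)"
    and c0: "\<And>n. n \<in> {1..N} \<Longrightarrow> c 0 n = s0"
    and C1: "\<And>n j. n \<in> {1..N} \<Longrightarrow> j < J \<Longrightarrow> c j n \<ge> c (Suc j) n"
    and C1': "\<And>n. n \<in> {1..N} \<Longrightarrow> c J n \<ge> 0"
    and C2a: "\<And>n. n \<in> {1..N} \<Longrightarrow> 1 \<ge> (c 0 n - c 1 n) / x 1"
    and C2b: "\<And>n j. n \<in> {1..N} \<Longrightarrow> 1 \<le> j \<Longrightarrow> j < J \<Longrightarrow>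
               (c (j - 1) n - c j n) / (x j - x (j - 1)) \<ge> (c j n - c (Suc j) n) / (x (Suc j) - x j)"
    and C3: "\<And>n j. 1 \<le> n \<Longrightarrow> n < N \<Longrightarrow> j \<le> J \<Longrightarrow> c j (Suc n) \<ge> c j n"
    and C4: "c J N = 0"
    and a_nonneg: "\<And>j n. j \<le> J \<Longrightarrow> n \<in> {1..N} \<Longrightarrow> a (x j) (t n) \<ge> 0"
  shows
    "Phi_val N t J x (pj J x s0 c) a = model_sup TYPE(nat list) N t J x s0 (pj J x s0 c) a
   \<and> model_sup TYPE(nat list) N t J x s0 (pj J x s0 c) a = hedge_inf N t J x (pj J x s0 c) a
   \<and> hedge_inf N t J x (pj J x s0 c) a = Psi_val N t J x (pj J x s0 c) a
   \<and> (\<forall>(M :: 'a measure) F X. is_model N J x s0 (pj J x s0 c) M F X \<longrightarrow>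
        phi N t a M F X \<le> Phi_val N t J x (pj J x s0 c) a)
   \<and> (\<exists>(M :: nat list measure) F X. is_model2 N J x s0 (pj J x s0 c) M F X
        \<and> phi N t a M F X = Phi_val N t J x (pj J x s0 c) a)
   \<and> (\<exists>e1 e2 v d1 d2.
        super_replicates N t J x a (markov_b N e1 e2 v) (markov_theta1 J x d1) (markov_theta2 J x d2)
      \<and> strat_cost N J (pj J x s0 c) (markov_b N e1 e2 v) = hedge_inf N t J x (pj J x s0 c) a)
   \<and> (\<forall>b \<Theta>1 \<Theta>2. super_replicates N t J x a b \<Theta>1 \<Theta>2 \<longrightarrow>
        hedge_inf N t J x (pj J x s0 c) a \<le> strat_cost N J (pj J x s0 c) b)"
proof -
  interpret call_prices N J x s0 c
    by unfold_locales (fact N_pos J_pos x0 x_mono c0 C1 C1' C2a C2b C3 C4)+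
  let ?val = "\<lambda>f. \<Sum>n=1..N. \<Sum>j\<le>J. a (x j) (t n) * f j n"
  let ?cost = "\<lambda>e1 e2 v. (\<Sum>n=1..N. \<Sum>j\<le>J. (e1 j n + e2 j n) * p j n) + (\<Sum>j\<le>J. v j N * p j N)"
  obtain e1 e2 v d1 d2 f g1 g2 where dual: "dual_feasible N t J x a e1 e2 v d1 d2"
    and primal: "primal_feasible N J x p f g1 g2" and gap: "?cost e1 e2 v \<le> ?val f"
    using lp_solution[where a = a and t = t, OF a_nonneg] by blast
  define V where "V = ?val f"
  note sup = markov_strategy_super_replicates[OF strike_inj N_pos dual]
  obtain M :: "nat list measure" and F X where M: "is_model2 N J x s0 p M F X" "V \<le> phi N t a M F X"
    using ex_model2_ge[where a = a and t = t, OF a_nonneg primal sup] unfolding V_def by blast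
  have model: "is_model N J x s0 p M F X" using M(1) by (simp add: is_model2_def)
  have cost_eq: "?cost e1 e2 v = strat_cost N J p (markov_b N e1 e2 v)"
    using markov_strategy_cost[OF N_pos] by simp
  have V_le: "V \<le> strat_cost N J p b" if "super_replicates N t J x a b \<Theta>1 \<Theta>2" for b \<Theta>1 \<Theta>2
    using M(2) phi_le_strat_cost[OF N_pos model that] by simp
  have cost: "strat_cost N J p (markov_b N e1 e2 v) = V"
    using gap V_le[OF sup] cost_eq by (simp add: V_def)
  \<comment> \<open>Polymorphic in the sample type, since it is used both for
    \<open>nat list\<close> and for the \<open>'a\<close> of the statement.\<close>
  have phi_le: "phi N t a M' F' X' \<le> V" if "is_model N J x s0 p M' F' X'"
    for M' :: "'b measure" and F' X'
    using phi_le_strat_cost[OF N_pos that sup] cost by simp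
  have phi_M: "phi N t a M F X = V" using M(2) phi_le[OF model] by simp
  have Phi: "Phi_val N t J x p a = V"
    unfolding Phi_val_def
  proof (rule cSup_eq_maximum)
    show "V \<in> {?val f | f g1 g2. primal_feasible N J x p f g1 g2}"
      using primal unfolding V_def by blast
    \<comment> \<open>Other primal points are bounded through the models that they generate, so LP
      weak duality is not invoked separately.\<close>
    fix r assume "r \<in> {?val f | f g1 g2. primal_feasible N J x p f g1 g2}"
    then obtain f' g1' g2' where r: "r = ?val f'" and "primal_feasible N J x p f' g1' g2'" by blast
    then obtain M' :: "nat list measure" and F' X' where
      "is_model2 N J x s0 p M' F' X'" "r \<le> phi N t a M' F' X'"
      using ex_model2_ge[where a = a and t = t, OF a_nonneg _ sup] by blast
    then show "r \<le> V" using phi_le[of M' F' X'] by (simp add: is_model2_def)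
  qed
  have sup_eq: "model_sup TYPE(nat list) N t J x s0 p a = V"
    unfolding model_sup_def
  proof (rule cSup_eq_maximum)
    show "V \<in> {phi N t a M F X | (M :: nat list measure) F X. is_model N J x s0 p M F X}"
      using model phi_M by blast
  qed (use phi_le in blast)
  have hedge: "hedge_inf N t J x p a = V"
    unfolding hedge_inf_def
  proof (rule cInf_eq_minimum)
    show "V \<in> {strat_cost N J p b | b \<Theta>1 \<Theta>2. super_replicates N t J x a b \<Theta>1 \<Theta>2}"
      using sup cost by blast
  qed (use V_le in blast)
  have Psi: "Psi_val N t J x p a = V"
    unfolding Psi_val_def
  proof (rule cInf_eq_minimum)
    have "V = ?cost e1 e2 v" using cost cost_eq by simp
    then show "V \<in> {?cost e1 e2 v | e1 e2 v d1 d2. dual_feasible N t J x a e1 e2 v d1 d2}"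
      using dual by blast
    \<comment> \<open>Likewise, another dual point is bounded through the strategy that it
      defines.\<close>
    fix r assume "r \<in> {?cost e1 e2 v | e1 e2 v d1 d2. dual_feasible N t J x a e1 e2 v d1 d2}"
    then obtain e1' e2' v' d1' d2' where r: "r = ?cost e1' e2' v'"
      and dual': "dual_feasible N t J x a e1' e2' v' d1' d2'" by blast
    show "V \<le> r"
      using V_le[OF markov_strategy_super_replicates[OF strike_inj N_pos dual']]
        markov_strategy_cost[OF N_pos, of J p e1' e2' v'] r by simp
  qed
  show ?thesis
    unfolding Phi sup_eq hedge Psi using phi_le M(1) phi_M sup cost V_le by blast
qed

end
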